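(* Let $T$ be a (semistandard) tableau. Then the right key $R(T)$ of $T$ is equal to the scanning tableau $S(T)$ of $T$.
   Context: Conventions (English notation, columns indexed left to right, rows top to bottom). A shape is a weakly decreasing sequence $\zeta=(\zeta_1\ge\zeta_2\ge\dots\ge\zeta_k)$ of positive integers (column lengths); its Young diagram has $\zeta_i$ top-justified boxes in column $i$. A tableau of shape $\zeta$ is a filling of this diagram with positive integers, strictly increasing down columns and weakly increasing along rows. $T_i$ denotes the $i$th column of $T$; $l(C)$ is the length of a column $C$. A tableau $T$ is a key if for $1<i\le k$ every entry of $T_i$ also appears in $T_{i-1}$. Earliest weakly increasing subsequence (EWIS): for a sequence $(x_1,x_2,\dots)$ it is $(x_{i_1},x_{i_2},\dots)$ with $i_1=1$ and, for $j>1$, $i_j$ the smallest index $>i_{j-1}$ with $x_{i_j}\ge x_{i_{j-1}}$ (stopping when none exists). Scanning tableau: for a tableau $T$ with $k$ columns, let $b_i$ be the bottom entry of $T_i$, let $e=(e_1,\dots,e_m)$ be the EWIS of $b=(b_1,\dots,b_k)$, and let $d$ be the set of boxes of $T$ containing the members of $e$ (the bottom boxes of the chosen columns); $T\setminus d$ (removing those boxes) is again a tableau. Write $x\odot C$ for the column obtained by attaching entry $x$ to the bottom of column $C$, and $C\oplus U$ for prepending column $C$ to the left of $U$. Define recursively: $S_{1B}(T):=e_m$ (and $S_{1B}(T):=\emptyset$ if $T$ is empty), $S_1(T):=S_{1B}(T)\odot S_1(T\setminus d)$, and $S(T):=S_1(T)\oplus S(T\setminus T_1)$, where $T\setminus T_1$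 removes the first column. $S(T)$ has the same shape as $T$. Right key: For shapes $\zeta$ (with $k$ lengths) and $\eta$ (with $l\le k$ lengths, $\eta_i\le\zeta_i$), the skew diagram $\zeta\setminus\eta$ is the diagram of $\zeta$ with that of $\eta$ removed; its column lengths are $(\zeta_1-\eta_1,\dots,\zeta_l-\eta_l,\zeta_{l+1},\dots,\zeta_k)$ (possibly zero). A skew tableau is a filling of a skew diagram strictly increasing down columns and weakly increasing along rows. Jeu de taquin (JDT) slides, reverse jeu de taquin (RJDT) slides, and rectification are as in Fulton's "Young Tableaux"; rectification is unchanged by JDT and RJDT slides. A skew tableau is frank if its column lengths are a rearrangement of the column lengths of (the shape of) its rectification. It is known that for a tableau $T$ and a skew diagram whose column lengths are a rearrangement of those of $T$, there is a unique skew tableau on it rectifying to $T$; consequently the rightmost column of a frank skew tableau rectifying to $T$ depends only on its length. For $T$ of shape $\zeta$ with $k$ columns and $1\le i\le k$, $R_i(T)$ is the rightmost column of any frank skew tableau whose rightmost column has length $\zeta_i$ and which rectifies to $T$; the right key is $R(T):=R_1(T)\oplus R_2(T)\oplus\dots\oplus R_k(T)$ (columns placed left to right), a tableau of shape $\zeta$. *)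

theory Defs
  imports Main "HOL-Library.Multiset"
begin

text \<open>
  English notation.  Columns and rows are counted from 0, and a box is a pair
  \<open>(column, row)\<close>: the box below \<open>(i, j)\<close> is \<open>(i, Suc j)\<close> and the box to its right is
  \<open>(Suc i, j)\<close>.  Shapes are given by their column lengths, and a column is the list of its
  entries from top to bottom.
\<close>

section \<open>Shapes and tableaux\<close>

type_synonym box = "nat \<times> nat"

definition shape :: "nat list \<Rightarrow> bool" where
  "shape z \<longleftrightarrow> sorted_wrt (\<ge>) z \<and> (\<forall>n\<in>set z. 0 < n)"

definition diagram :: "nat list \<Rightarrow> box set" where
  "diagram z = {(i, j). i < length z \<and> j < z ! i}"

type_synonym tableau = "nat list list"

definition is_tableau :: "tableau \<Rightarrow> bool" where
  "is_tableau T \<longleftrightarrow>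
     shape (map length T) \<and>
     (\<forall>C\<in>set T. (\<forall>x\<in>set C. 0 < x) \<and> sorted_wrt (<) C) \<and>
     (\<forall>i i' j. i < i' \<and> i' < length T \<and> j < length (T ! i') \<longrightarrow> T ! i ! j \<le> T ! i' ! j)"


section \<open>The scanning tableau\<close>

text \<open>
  \<open>ewis_next v i xs\<close> continues the earliest weakly increasing subsequence after a chosen
  member \<open>v\<close>, where \<open>xs\<close> is the rest of the sequence and \<open>i\<close> the index of its first member.
  Indices rather than values are recorded, since the scanning removes the boxes that contain
  the members.
\<close>

fun ewis_next :: "nat \<Rightarrow> nat \<Rightarrow> nat list \<Rightarrow> nat list" where
  "ewis_next v i [] = []"
| "ewis_next v i (x # xs) =
     (if v \<le> x then i # ewis_next x (Suc i) xs else ewis_next v (Suc i) xs)"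

fun ewis_indices :: "nat list \<Rightarrow> nat list" where
  "ewis_indices [] = []"
| "ewis_indices (x # xs) = 0 # ewis_next x 1 xs"

definition ewis :: "nat list \<Rightarrow> nat list" where
  "ewis xs = map (\<lambda>i. xs ! i) (ewis_indices xs)"

definition bottoms :: "tableau \<Rightarrow> nat list" where
  "bottoms T = map last T"

text \<open>\<open>T \<setminus> d\<close>; columns that have lost their only box are dropped from the list.\<close>

definition remove_scanned :: "tableau \<Rightarrow> tableau" where
  "remove_scanned T =
     filter (\<lambda>C. C \<noteq> [])
       (map (\<lambda>i. if i \<in> set (ewis_indices (bottoms T)) then butlast (T ! i) else T ! i)
         [0..<length T])"

lemma remove_scanned_Cons:
  "\<exists>g. (\<forall>i. length (g i) \<le> length (U ! i)) \<and>
     remove_scanned (C # U) = filter (\<lambda>C. C \<noteq> []) (butlast C # map g [0..<length U])"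
  unfolding remove_scanned_def
  by (intro exI[of _ "\<lambda>i. if Suc i \<in> set (ewis_indices (bottoms (C # U)))
        then butlast (U ! i) else U ! i"])
     (auto simp: bottoms_def upt_conv_Cons map_Suc_upt[symmetric] o_def
        simp del: upt_Suc intro!: arg_cong[where f = "filter _"])

text \<open>\<open>S1B\<close> is only meant for nonempty tableaux; the empty case is covered in \<open>S1\<close>.\<close>

definition S1B :: "tableau \<Rightarrow> nat" where
  "S1B T = last (ewis (bottoms T))"

lemma size_filter_nonempty_le:
  "sum_list (map (\<lambda>C. Suc (length C)) (filter (\<lambda>C. C \<noteq> []) xs))
     \<le> sum_list (map (\<lambda>C. Suc (length C)) xs)"
  by (induction xs) auto

function S1 :: "tableau \<Rightarrow> nat list" where
  "S1 T = (if T = [] then [] else S1 (remove_scanned T) @ [S1B T])"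
  by auto
termination
proof (relation "measure (\<lambda>T. sum_list (map (\<lambda>C. Suc (length C)) T))", goal_cases)
  case 1 show ?case by simp
next
  case (2 T)
  then obtain C U where T: "T = C # U" by (cases T) auto
  obtain g where g: "\<forall>i. length (g i) \<le> length (U ! i)"
    "remove_scanned (C # U) = filter (\<lambda>C. C \<noteq> []) (butlast C # map g [0..<length U])"
    using remove_scanned_Cons by blast
  let ?s = "\<lambda>xs :: tableau. sum_list (map (\<lambda>C. Suc (length C)) xs)"
  have "?s (map g [0..<length U]) \<le> ?s (map (\<lambda>i. U ! i) [0..<length U])"
    using g(1) by (auto simp: o_def intro!: sum_list_mono)
  then have "?s (filter (\<lambda>C. C \<noteq> []) (map g [0..<length U])) \<le> ?s U"
    using size_filter_nonempty_le[of "map g [0..<length U]"] by (simp add: map_nth)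
  then have "?s (remove_scanned T) < ?s T"
    unfolding T g(2) by (cases C) auto
  then show ?case by simp
qed

declare S1.simps [simp del]

fun scanning_tableau :: "tableau \<Rightarrow> tableau" where
  "scanning_tableau [] = []"
| "scanning_tableau (C # U) = S1 (C # U) # scanning_tableau U"


section \<open>Skew tableaux and jeu de taquin\<close>

text \<open>
  The outer and inner shape are part of the data, since the columns (some possibly of
  length 0) and the inside corners are not determined by the set of boxes alone.
\<close>

datatype skew_filling =
  Skew (outer: "nat list") (inner: "nat list") (entry: "box \<Rightarrow> nat option")

definition inner_length :: "skew_filling \<Rightarrow> nat \<Rightarrow> nat" where
  "inner_length X i = (if i < length (inner X) then inner X ! i else 0)"

definition skew_columns :: "skew_filling \<Rightarrow> nat list list" where
  "skew_columns X =
     map (\<lambda>i. map (\<lambda>j. the (entry X (i, j))) [inner_length X i..<outer X ! i])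
       [0..<length (outer X)]"

definition is_skew_tableau :: "skew_filling \<Rightarrow> bool" where
  "is_skew_tableau X \<longleftrightarrow>
     shape (outer X) \<and> shape (inner X) \<and>
     length (inner X) \<le> length (outer X) \<and>
     (\<forall>i < length (inner X). inner X ! i \<le> outer X ! i) \<and>
     dom (entry X) = diagram (outer X) - diagram (inner X) \<and>
     (\<forall>x\<in>ran (entry X). 0 < x) \<and>
     (\<forall>i j j' x y. j < j' \<and> entry X (i, j) = Some x \<and> entry X (i, j') = Some y \<longrightarrow> x < y) \<and>
     (\<forall>i i' j x y. i < i' \<and> entry X (i, j) = Some x \<and> entry X (i', j) = Some y \<longrightarrow> x \<le> y)"

definition inside_corner :: "nat list \<Rightarrow> box \<Rightarrow> bool" where
  "inside_corner y c \<longleftrightarrow> (case c of (i, j) \<Rightarrow>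
     (i, j) \<in> diagram y \<and> (i, Suc j) \<notin> diagram y \<and> (Suc i, j) \<notin> diagram y)"

text \<open>
  \<open>slide_hole f c g d\<close>: starting from the filling \<open>f\<close> with an empty box at \<open>c\<close>, the sliding
  ends with the filling \<open>g\<close> and the empty box at \<open>d\<close>.  The smaller of the two neighbours
  below and to the right moves into the hole, and the one below if they are equal.
\<close>

inductive slide_hole ::
    "(box \<Rightarrow> nat option) \<Rightarrow> box \<Rightarrow> (box \<Rightarrow> nat option) \<Rightarrow> box \<Rightarrow> bool" where
  finished:
    "\<lbrakk>f (i, Suc j) = None; f (Suc i, j) = None\<rbrakk> \<Longrightarrow> slide_hole f (i, j) f (i, j)"
| from_below:
    "\<lbrakk>f (i, Suc j) = Some x; \<And>y. f (Suc i, j) = Some y \<Longrightarrow> x \<le> y;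
      slide_hole (f((i, j) := Some x, (i, Suc j) := None)) (i, Suc j) g d\<rbrakk>
     \<Longrightarrow> slide_hole f (i, j) g d"
| from_right:
    "\<lbrakk>f (Suc i, j) = Some y; \<And>x. f (i, Suc j) = Some x \<Longrightarrow> y < x;
      slide_hole (f((i, j) := Some y, (Suc i, j) := None)) (Suc i, j) g d\<rbrakk>
     \<Longrightarrow> slide_hole f (i, j) g d"

text \<open>
  The starting corner leaves the inner shape and the final hole leaves the outer shape.  If
  the inside corner is also an outside corner, both are the same box and no entry moves.
\<close>

definition jdt_slide :: "skew_filling \<Rightarrow> skew_filling \<Rightarrow> bool" where
  "jdt_slide X Y \<longleftrightarrow> (\<exists>c d.
     inside_corner (inner X) c \<and> slide_hole (entry X) c (entry Y) d \<and>
     shape (inner Y) \<and> diagram (inner Y) = diagram (inner X) - {c} \<and>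
     shape (outer Y) \<and> diagram (outer Y) = diagram (outer X) - {d})"

definition straight :: "tableau \<Rightarrow> skew_filling" where
  "straight T =
     Skew (map length T) []
       (\<lambda>(i, j). if (i, j) \<in> diagram (map length T) then Some (T ! i ! j) else None)"

definition rectifies_to :: "skew_filling \<Rightarrow> tableau \<Rightarrow> bool" where
  "rectifies_to X T \<longleftrightarrow> jdt_slide\<^sup>*\<^sup>* X (straight T)"


section \<open>The right key\<close>

definition frank :: "skew_filling \<Rightarrow> bool" where
  "frank X \<longleftrightarrow> is_skew_tableau X \<and>
     (\<exists>T. rectifies_to X T \<and> mset (map length (skew_columns X)) = mset (map length T))"

definition right_key_column :: "tableau \<Rightarrow> nat \<Rightarrow> nat list" where
  "right_key_column T i =
     (THE C. \<exists>X. frank X \<and> rectifies_to X T \<and>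
        C = last (skew_columns X) \<and> length C = length (T ! i))"

definition right_key :: "tableau \<Rightarrow> tableau" where
  "right_key T = map (right_key_column T) [0..<length T]"

end

theory Submission imports Defs begin

text \<open>
  Consider tuples of columns, that is, of finite sets of positive integers, with the raising
  operators of the type A crystal in which the \<open>i\<close>-th operator moves one entry from column
  \<open>i + 1\<close> to column \<open>i\<close>, chosen by the usual bracketing rule.  A horizontal move of a jeu
  de taquin slide is such an operator and a vertical move does not change the columns, so the
  rectification is the highest weight element of the crystal component.  It is unique because
  the operators are locally confluent.

  A frank skew tableau has extremal weight: its sum of squared column lengths is maximal in
  its component.  Hence in any two adjacent columns the entries of the shorter one are all
  matched, and the reflection that exchanges their lengths is determined.  Sorting the columns
  by reflections leads to \<open>T\<close>, and undoing them expresses the last column by passing the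
  column \<open>T\<^sub>i\<close> through the columns to its right, one at a time.  Passing the entries
  from bottom to top one by one through all columns instead gives the earliest weakly
  increasing subsequences of the scanning tableau.
\<close>

section \<open>Raising operators on tuples of columns\<close>

text \<open>The bracketing is never carried out. \<open>height\<close> is the surplus of column
  \<open>i + 1\<close> over column \<open>i\<close> among the entries up to a bound, and the entry
  to move sits at the first maximum of this function. Since a move changes the heights by constants
  from the moved entry on, statements about operators become arithmetic with heights.

  Undoing a reflection becomes absorption through an invariant: a move takes an unmatched entry of
  one column of a pair to the other, where it is again unmatched. The second column at the end of
  the string of moves, where all unmatched entries are on the right, can therefore be computed from
  any pair on the string.

  Forgetting the rows loses nothing, because any tuple of nonempty columns belongs to some skew
  tableau. A frank skew tableau with a prescribed last length is therefore built by inverse moves on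
  tuples rather than by reverse slides. Its existence serves twice: it makes
  \<open>right_key_column\<close> well defined, and it shows that the absorbed column is as long as
  the column it started from, so that \<open>S1\<close> stops in time.\<close>

type_synonym columns = "nat \<Rightarrow> nat set"

text \<open>Reading upwards, an entry of column \<open>i + 1\<close> counts 1 and an entry of column
  \<open>i\<close> counts -1. The maximum over all \<open>x\<close> is the number of entries of
  column \<open>i + 1\<close> left unmatched when partners in column \<open>i\<close> must be at
  most as large.\<close>

definition height :: "columns \<Rightarrow> nat \<Rightarrow> nat \<Rightarrow> int" where
  "height c i x = int (card (c (Suc i) \<inter> {..x})) - int (card (c i \<inter> {..x}))"

text \<open>Excluding 0 makes every height start at 0; the empty columns from \<open>k\<close> on
  make a tuple recoverable from its heights.\<close>

definition columns_within :: "nat \<Rightarrow> columns \<Rightarrow> bool" where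
  "columns_within k c \<longleftrightarrow> (\<forall>i. finite (c i) \<and> 0 \<notin> c i) \<and> (\<forall>i\<ge>k. c i = {})"

text \<open>The first maximum marks the largest unmatched entry of column \<open>i + 1\<close>. If
  no height is positive, the first maximum is at 0, which \<open>0 < y\<close> rules out.\<close>

definition movable :: "columns \<Rightarrow> nat \<Rightarrow> nat \<Rightarrow> bool" where
  "movable c i y \<longleftrightarrow> 0 < y \<and> (\<forall>x<y. height c i x < height c i y) \<and>
     (\<forall>x\<ge>y. height c i x \<le> height c i y)"

definition move :: "columns \<Rightarrow> nat \<Rightarrow> nat \<Rightarrow> columns" where
  "move c i y = c(i := insert y (c i), Suc i := c (Suc i) - {y})"

definition step :: "columns \<Rightarrow> columns \<Rightarrow> bool" where
  "step c d \<longleftrightarrow> (\<exists>i y. movable c i y \<and> d = move c i y)"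

lemma stepI: "movable c i y \<Longrightarrow> step c (move c i y)"
  by (auto simp: step_def)

lemma movableI:
  assumes "0 < y" "\<And>x. x < y \<Longrightarrow> height c i x < height c i y"
    "\<And>x. y \<le> x \<Longrightarrow> height c i x \<le> height c i y"
  shows "movable c i y"
  using assms by (simp add: movable_def)

section \<open>Heights of column pairs and the effect of a move\<close>

lemma card_Int_atMost_Suc:
  fixes C :: "nat set"
  assumes "finite C"
  shows "card (C \<inter> {..Suc x}) = card (C \<inter> {..x}) + of_bool (Suc x \<in> C)"
  using assms by (simp add: atMost_Suc)

lemma card_insert_Int_atMost:
  fixes C :: "nat set"
  assumes "finite C" "y \<notin> C"
  shows "card (insert y C \<inter> {..x}) = card (C \<inter> {..x}) + of_bool (y \<le> x)"
  using assms by (simp add: Int_insert_left)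

lemma card_remove_Int_atMost:
  fixes C :: "nat set"
  assumes "finite C" "y \<in> C"
  shows "int (card ((C - {y}) \<inter> {..x})) = int (card (C \<inter> {..x})) - of_bool (y \<le> x)"
  using card_insert_Int_atMost[of "C - {y}" y x] assms by (simp add: insert_absorb)

lemma height_0: "columns_within k c \<Longrightarrow> height c i 0 = 0"
  by (simp add: height_def columns_within_def)

lemma height_Suc:
  assumes "columns_within k c"
  shows "height c i (Suc x) = height c i x + of_bool (Suc x \<in> c (Suc i)) - of_bool (Suc x \<in> c i)"
  using assms by (simp add: height_def columns_within_def card_Int_atMost_Suc)

lemma columns_bounded:
  assumes "columns_within k c"
  obtains N where "\<And>i. c i \<subseteq> {..N}"
proof -
  have "finite (\<Union>i<k. c i)"
    using assms by (simp add: columns_within_def)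
  then obtain N where "\<forall>x\<in>(\<Union>i<k. c i). x \<le> N"
    using finite_nat_set_iff_bounded_le by metis
  then have "c i \<subseteq> {..N}" for i
    using assms by (cases "i < k") (auto simp: columns_within_def)
  then show thesis by (rule that)
qed

lemma height_eq_card_diff:
  assumes "\<And>i. c i \<subseteq> {..N}" "N \<le> x"
  shows "height c i x = int (card (c (Suc i))) - int (card (c i))"
proof -
  have "c j \<inter> {..x} = c j" for j
    using assms by fastforce
  then show ?thesis by (simp add: height_def)
qed

lemma movable_mem:
  assumes "columns_within k c" "movable c i y"
  shows "y \<in> c (Suc i)" "y \<notin> c i" "Suc i < k"
proof -
  obtain x where y: "y = Suc x"
    using assms(2) by (cases y) (auto simp: movable_def)
  have "height c i x < height c i (Suc x)"
    using assms(2) by (auto simp: movable_def y)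
  then show "y \<in> c (Suc i)" "y \<notin> c i"
    using height_Suc[OF assms(1), of i x] y by (auto split: if_splits)
  then show "Suc i < k"
    using assms(1) unfolding columns_within_def by (metis empty_iff not_le)
qed

lemma columns_within_move:
  assumes "columns_within k c" "movable c i y"
  shows "columns_within k (move c i y)"
  using assms movable_mem[OF assms]
  by (auto simp: columns_within_def move_def movable_def)

text \<open>The changes -2, 1 and 0 are the negated entries of the Cartan matrix of type A. All
  comparisons of different operators are computed from them.\<close>

lemma height_move:
  assumes "columns_within k c" "movable c i y"
  shows "height (move c i y) m x = height c m x +
    (if y \<le> x then if m = i then -2 else if m = Suc i \<or> Suc m = i then 1 else 0 else 0)"
proof -
  have fin: "finite (c j)" for j
    using assms(1) by (simp add: columns_within_def)
  note c = card_insert_Int_atMost[OF fin movable_mem(2)[OF assms], of x]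
    card_remove_Int_atMost[OF fin movable_mem(1)[OF assms], of x]
  consider "m = i" | "m = Suc i" | "Suc m = i" | "m \<noteq> i" "m \<noteq> Suc i" "Suc m \<noteq> i"
    by blast
  then show ?thesis
    by cases (use c in \<open>auto simp: height_def move_def\<close>)
qed

lemma card_move:
  assumes "columns_within k c" "movable c i y"
  shows "card (move c i y i) = Suc (card (c i))"
    "Suc (card (move c i y (Suc i))) = card (c (Suc i))"
    "m \<noteq> i \<Longrightarrow> m \<noteq> Suc i \<Longrightarrow> move c i y m = c m"
proof -
  have fin: "finite (c j)" for j
    using assms(1) by (simp add: columns_within_def)
  show "card (move c i y i) = Suc (card (c i))"
    using fin movable_mem[OF assms] by (simp add: move_def)
  show "Suc (card (move c i y (Suc i))) = card (c (Suc i))"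
    using fin movable_mem[OF assms]
    by (metis card_Suc_Diff1 fun_upd_same move_def)
  show "m \<noteq> i \<Longrightarrow> m \<noteq> Suc i \<Longrightarrow> move c i y m = c m"
    by (simp add: move_def)
qed

lemma movable_unique:
  assumes "movable c i y" "movable c i z"
  shows "y = z"
  using assms unfolding movable_def by (metis linorder_neqE_nat nat_less_le not_le)

lemma movable_exists:
  assumes c: "columns_within k c" and x: "0 < height c i x"
  obtains y where "movable c i y" "\<And>z. height c i z \<le> height c i y"
proof -
  obtain N where N: "\<And>i. c i \<subseteq> {..N}"
    using columns_bounded[OF c] by blast
  define m where "m = Max (height c i ` {..N + x})"
  have fin: "finite (height c i ` {..N + x})" by simp
  have le: "height c i z \<le> m" for z
  proof (cases "z \<le> N + x")
    case True
    then show ?thesis unfolding m_def by (intro Max_ge[OF fin]) auto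
  next
    case False
    then have "height c i z = height c i (N + x)"
      using height_eq_card_diff[OF N] by simp
    then show ?thesis unfolding m_def by (simp add: Max_ge[OF fin])
  qed
  have "m \<in> height c i ` {..N + x}"
    unfolding m_def by (rule Max_in) auto
  then obtain z where z: "height c i z = m" by blast
  define y where "y = (LEAST z. height c i z = m)"
  have y: "height c i y = m"
    unfolding y_def using z by (rule LeastI)
  have lt: "height c i z < m" if "z < y" for z
    using not_less_Least[OF that[unfolded y_def]] le[of z] by simp
  have "y \<noteq> 0"
    using height_0[OF c, of i] y le[of x] x by (metis not_le)
  then have "movable c i y"
    unfolding movable_def y using le lt by simp
  then show thesis using that le y by blast
qed

text \<open>Starting from the empty column \<open>k\<close>, a downward induction recovers the
  counts of each column from the heights, and counts jump exactly at members. Equality of two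
  results of moves thus reduces to adding up height changes.\<close>

lemma columns_eqI:
  assumes c: "columns_within k c" and d: "columns_within k d"
    and h: "\<And>i x. height c i x = height d i x"
  shows "c = d"
proof -
  have eq: "card (c i \<inter> {..x}) = card (d i \<inter> {..x})" for i x
  proof (cases "i \<le> k")
    case True
    then show ?thesis
    proof (induction rule: inc_induct)
      case base
      then show ?case using c d by (simp add: columns_within_def)
    next
      case (step i)
      then show ?case using h[of i x] by (simp add: height_def)
    qed
  next
    case False
    then show ?thesis using c d by (simp add: columns_within_def)
  qed
  have "x \<in> c i \<longleftrightarrow> x \<in> d i" for i x
  proof (cases x)
    case 0
    then show ?thesis using c d by (simp add: columns_within_def)
  next
    case (Suc y)
    have "finite (c i)" "finite (d i)"
      using c d by (auto simp: columns_within_def)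
    then show ?thesis
      using eq[of i y] eq[of i "Suc y"] Suc by (simp add: card_Int_atMost_Suc of_bool_eq_iff)
  qed
  then show ?thesis by blast
qed

lemma step_within: "columns_within k c \<Longrightarrow> step c d \<Longrightarrow> columns_within k d"
  by (auto simp: step_def columns_within_move)

lemma steps_within: "step\<^sup>*\<^sup>* c d \<Longrightarrow> columns_within k c \<Longrightarrow> columns_within k d"
  by (induction rule: rtranclp_induct) (auto intro: step_within)

text \<open>
  This is Stembridge's local rule for simply laced crystals: the two moves either commute or
  are completed to moves \<open>i j j i\<close> and \<open>j i i j\<close> with the same result.
\<close>

lemma step_confluent_adjacent:
  assumes c: "columns_within k c" and adj: "j = Suc i \<or> i = Suc j"
    and p: "movable c i p" and q: "movable c j q" and "q < p"
  shows "\<exists>d. step\<^sup>*\<^sup>* (move c i p) d \<and> step\<^sup>*\<^sup>* (move c j q) d"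
proof -
  define a where "a = move c i p"
  define b where "b = move c j q"
  define hi where "hi = height c i"
  define hj where "hj = height c j"
  have hpi: "hi x < hi p" if "x < p" for x using p that by (simp add: movable_def hi_def)
  have hpi': "hi x \<le> hi p" for x
    using p by (cases "x < p") (auto simp: movable_def hi_def)
  have hqj: "hj x < hj q" if "x < q" for x using q that by (simp add: movable_def hj_def)
  have hqj': "hj x \<le> hj q" for x
    using q by (cases "x < q") (auto simp: movable_def hj_def)
  have pos: "0 < p" "0 < q" using p q by (auto simp: movable_def)
  have a: "columns_within k a" and b: "columns_within k b"
    unfolding a_def b_def using c p q by (auto intro: columns_within_move)
  have a_i: "height a i x = hi x + (if p \<le> x then -2 else 0)" for x
    unfolding a_def hi_def height_move[OF c p] by simp
  have a_j: "height a j x = hj x + (if p \<le> x then 1 else 0)" for x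
    unfolding a_def hj_def height_move[OF c p] using adj by auto
  have b_i: "height b i x = hi x + (if q \<le> x then 1 else 0)" for x
    unfolding b_def hi_def height_move[OF c q] using adj by auto
  have b_j: "height b j x = hj x + (if q \<le> x then -2 else 0)" for x
    unfolding b_def hj_def height_move[OF c q] by simp
  \<comment> \<open>Moving \<open>q\<close> lifts the height of \<open>i\<close> by 1 from
    \<open>q\<close> on. As \<open>q < p\<close>, the first maximum stays at
    \<open>p\<close>.\<close>
  have bp: "movable b i p"
  proof (rule movableI)
    fix x
    note facts = hpi[of x] hpi'[of x] \<open>q < p\<close> pos
    show "x < p \<Longrightarrow> height b i x < height b i p"
      unfolding b_i using facts by (cases "p \<le> x"; cases "q \<le> x"; simp split: if_split)
    show "p \<le> x \<Longrightarrow> height b i x \<le> height b i p"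
      unfolding b_i using facts by (cases "p \<le> x"; cases "q \<le> x"; simp split: if_split)
  qed (use pos in simp)
  define b1 where "b1 = move b i p"
  have b1: "columns_within k b1"
    unfolding b1_def using b bp by (rule columns_within_move)
  show ?thesis
  proof (cases "\<forall>x\<ge>p. hj x < hj q")
    case True
    \<comment> \<open>The lift by 1 from \<open>p\<close> on does not exceed the value at
      \<open>q\<close>, so here the two moves commute.\<close>
    have aq: "movable a j q"
    proof (rule movableI)
      fix x
      note facts = hqj[of x] hqj'[of x] True[rule_format, of x] \<open>q < p\<close> pos
      show "x < q \<Longrightarrow> height a j x < height a j q"
        unfolding a_j using facts by (cases "p \<le> x"; cases "q \<le> x"; simp split: if_split)
      show "q \<le> x \<Longrightarrow> height a j x \<le> height a j q"
        unfolding a_j using facts by (cases "p \<le> x"; cases "q \<le> x"; simp split: if_split)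
    qed (use pos in simp)
    have "move a j q = b1"
    proof (rule columns_eqI)
      show "columns_within k (move a j q)" using a aq by (rule columns_within_move)
      show "columns_within k b1" by (fact b1)
      show "height (move a j q) m x = height b1 m x" for m x
        unfolding b1_def height_move[OF a aq] height_move[OF b bp]
        unfolding a_def b_def height_move[OF c p] height_move[OF c q]
        by simp
    qed
    then have "step a b1" "step b b1"
      using stepI[OF aq] stepI[OF bp] by (auto simp: b1_def)
    then show ?thesis unfolding a_def b_def by blast
  next
    case False
    then have ex: "\<exists>x. p \<le> x \<and> hj x = hj q"
      using hqj' by (metis linorder_not_le order_antisym)
    \<comment> \<open>Moving \<open>p\<close> lifts the height of \<open>j\<close> by 1 from
      \<open>p\<close> on, so its new first maximum is where the old maximum first recurs at or
      beyond \<open>p\<close>.\<close>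
    define q' where "q' = (LEAST x. p \<le> x \<and> hj x = hj q)"
    have q': "p \<le> q'" "hj q' = hj q"
      using LeastI_ex[OF ex] unfolding q'_def by auto
    have q'_lt: "hj x < hj q" if "p \<le> x" "x < q'" for x
      using not_less_Least[OF that(2)[unfolded q'_def]] that(1) hqj'[of x] by auto
    have "hi (p - 1) = hi p - 1"
    proof -
      obtain r where r: "p = Suc r" using pos by (cases p) auto
      show ?thesis
        using hpi[of r] height_Suc[OF c, of i r] unfolding r hi_def[symmetric]
        by (auto split: if_splits)
    qed
    then have ex: "\<exists>x. q \<le> x \<and> hi x = hi p - 1"
      using \<open>q < p\<close> by (intro exI[of _ "p - 1"]) auto
    \<comment> \<open>In both orders the second move of \<open>i\<close> comes after that of
      \<open>q\<close>, which lifts the height of \<open>i\<close> by 1 from \<open>q\<close> on,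
      and after that of \<open>p\<close>, which lowers it by 2 from \<open>p\<close> on. The first
      maximum is then the first place from \<open>q\<close> on whose old height was one less than
      the maximum.\<close>
    define p1 where "p1 = (LEAST x. q \<le> x \<and> hi x = hi p - 1)"
    have p1: "q \<le> p1" "hi p1 = hi p - 1"
      using LeastI_ex[OF ex] unfolding p1_def by auto
    have p1_le: "p1 < p"
      using Least_le[of "\<lambda>x. q \<le> x \<and> hi x = hi p - 1" "p - 1"] \<open>hi (p - 1) = hi p - 1\<close> \<open>q < p\<close>
      unfolding p1_def by linarith
    have p1_lt: "hi x < hi p - 1" if "q \<le> x" "x < p1" for x
      using not_less_Least[OF that(2)[unfolded p1_def]] that hpi[of x] p1_le by auto

    have aq': "movable a j q'"
    proof (rule movableI)
      fix x
      note facts = hqj'[of x] q' q'_lt[of x] pos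
      show "x < q' \<Longrightarrow> height a j x < height a j q'"
        unfolding a_j using facts by (cases "p \<le> x"; cases "q \<le> x"; simp split: if_split)
      show "q' \<le> x \<Longrightarrow> height a j x \<le> height a j q'"
        unfolding a_j using facts by (cases "p \<le> x"; cases "q \<le> x"; simp split: if_split)
    qed (use pos q' in simp)
    define a1 where "a1 = move a j q'"
    have a1: "columns_within k a1" unfolding a1_def using a aq' by (rule columns_within_move)
    have a1_i: "height a1 i x = hi x + (if p \<le> x then -2 else 0) + (if q' \<le> x then 1 else 0)" for x
      unfolding a1_def height_move[OF a aq'] a_i using adj by auto
    have a1_j: "height a1 j x = hj x + (if p \<le> x then 1 else 0) + (if q' \<le> x then -2 else 0)" for x
      unfolding a1_def height_move[OF a aq'] a_j by auto
    have a1q: "movable a1 j q"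
    proof (rule movableI)
      fix x
      note facts = hqj[of x] hqj'[of x] q' q'_lt[of x] pos \<open>q < p\<close>
      show "x < q \<Longrightarrow> height a1 j x < height a1 j q"
        unfolding a1_j using facts by (cases "p \<le> x"; cases "q \<le> x"; cases "q' \<le> x"; simp split: if_split)
      show "q \<le> x \<Longrightarrow> height a1 j x \<le> height a1 j q"
        unfolding a1_j using facts by (cases "p \<le> x"; cases "q \<le> x"; cases "q' \<le> x"; simp split: if_split)
    qed (use pos in simp)
    define a2 where "a2 = move a1 j q"
    have a2: "columns_within k a2" unfolding a2_def using a1 a1q by (rule columns_within_move)
    have a2_i: "height a2 i x = hi x + (if p \<le> x then -2 else 0) + (if q' \<le> x then 1 else 0)
        + (if q \<le> x then 1 else 0)" for x
      unfolding a2_def height_move[OF a1 a1q] a1_i using adj by auto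
    have a2p: "movable a2 i p1"
    proof (rule movableI)
      fix x
      note facts = hpi[of x] hpi'[of x] p1 p1_le p1_lt[of x] q' pos \<open>q < p\<close>
      show "x < p1 \<Longrightarrow> height a2 i x < height a2 i p1"
        unfolding a2_i using facts by (cases "p \<le> x"; cases "q \<le> x"; cases "q' \<le> x"; cases "p1 \<le> x"; simp split: if_split)
      show "p1 \<le> x \<Longrightarrow> height a2 i x \<le> height a2 i p1"
        unfolding a2_i using facts by (cases "p \<le> x"; cases "q \<le> x"; cases "q' \<le> x"; cases "p1 \<le> x"; simp split: if_split)
    qed (use pos p1 \<open>q < p\<close> in simp)

    have b1_i: "height b1 i x = hi x + (if q \<le> x then 1 else 0) + (if p \<le> x then -2 else 0)" for x
      unfolding b1_def height_move[OF b bp] b_i by auto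
    have b1_j: "height b1 j x = hj x + (if q \<le> x then -2 else 0) + (if p \<le> x then 1 else 0)" for x
      unfolding b1_def height_move[OF b bp] b_j using adj by auto
    have b1p: "movable b1 i p1"
    proof (rule movableI)
      fix x
      note facts = hpi[of x] hpi'[of x] p1 p1_le p1_lt[of x] pos \<open>q < p\<close>
      show "x < p1 \<Longrightarrow> height b1 i x < height b1 i p1"
        unfolding b1_i using facts by (cases "p \<le> x"; cases "q \<le> x"; cases "p1 \<le> x"; simp split: if_split)
      show "p1 \<le> x \<Longrightarrow> height b1 i x \<le> height b1 i p1"
        unfolding b1_i using facts by (cases "p \<le> x"; cases "q \<le> x"; cases "p1 \<le> x"; simp split: if_split)
    qed (use pos p1 \<open>q < p\<close> in simp)
    define b2 where "b2 = move b1 i p1"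
    have b2: "columns_within k b2" unfolding b2_def using b1 b1p by (rule columns_within_move)
    have b2_j: "height b2 j x = hj x + (if q \<le> x then -2 else 0) + (if p \<le> x then 1 else 0)
        + (if p1 \<le> x then 1 else 0)" for x
      unfolding b2_def height_move[OF b1 b1p] b1_j using adj by auto
    have b2q: "movable b2 j q'"
    proof (rule movableI)
      fix x
      note facts = hqj[of x] hqj'[of x] q' q'_lt[of x] p1 p1_le pos \<open>q < p\<close>
      show "x < q' \<Longrightarrow> height b2 j x < height b2 j q'"
        unfolding b2_j using facts by (cases "p \<le> x"; cases "q \<le> x"; cases "p1 \<le> x"; cases "q' \<le> x"; simp split: if_split)
      show "q' \<le> x \<Longrightarrow> height b2 j x \<le> height b2 j q'"
        unfolding b2_j using facts by (cases "p \<le> x"; cases "q \<le> x"; cases "p1 \<le> x"; cases "q' \<le> x"; simp split: if_split)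
    qed (use pos q' in simp)

    have "move a2 i p1 = move b2 j q'"
    proof (rule columns_eqI)
      show "columns_within k (move a2 i p1)" using a2 a2p by (rule columns_within_move)
      show "columns_within k (move b2 j q')" using b2 b2q by (rule columns_within_move)
      show "height (move a2 i p1) m x = height (move b2 j q') m x" for m x
        unfolding height_move[OF a2 a2p] height_move[OF b2 b2q]
        unfolding a2_def b2_def height_move[OF a1 a1q] height_move[OF b1 b1p]
        unfolding a1_def b1_def height_move[OF a aq'] height_move[OF b bp]
        unfolding a_def b_def height_move[OF c p] height_move[OF c q]
        by (simp only: add_ac)
    qed
    moreover have "step a a1" "step a1 a2" "step a2 (move a2 i p1)"
        "step b b1" "step b1 b2" "step b2 (move b2 j q')"
      using aq' a1q a2p bp b1p b2q unfolding a1_def a2_def b1_def b2_def by (blast intro: stepI)+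
    ultimately show ?thesis
      unfolding a_def[symmetric] b_def[symmetric]
      by (intro exI[of _ "move a2 i p1"])
        (auto intro: converse_rtranclp_into_rtranclp)
  qed
qed

lemma step_locally_confluent:
  assumes c: "columns_within k c" and "step c a" "step c b"
  shows "\<exists>d. step\<^sup>*\<^sup>* a d \<and> step\<^sup>*\<^sup>* b d"
proof -
  obtain i p j q where p: "movable c i p" "a = move c i p" and q: "movable c j q" "b = move c j q"
    using assms by (auto simp: step_def)
  consider "i = j" | "j = Suc i \<or> i = Suc j" | "i \<noteq> j" "j \<noteq> Suc i" "i \<noteq> Suc j" by blast
  then show ?thesis
  proof cases
    case 1
    then show ?thesis using movable_unique p q by blast
  next
    case 2
    \<comment> \<open>The column shared by the two pairs contains one of the two entries and not the
      other.\<close>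
    have "p \<noteq> q"
      using 2 movable_mem[OF c p(1)] movable_mem[OF c q(1)] by auto
    then consider "q < p" | "p < q" by linarith
    then show ?thesis
    proof cases
      case 1
      then show ?thesis
        using step_confluent_adjacent[OF c 2 p(1) q(1)] p q by blast
    next
      case less: 2
      then show ?thesis
        using step_confluent_adjacent[OF c _ q(1) p(1)] 2 p q by blast
    qed
  next
    case 3
    have a: "columns_within k a" and b: "columns_within k b"
      using c p q by (auto intro: columns_within_move)
    have aq: "movable a j q" and bp: "movable b i p"
      using p q 3 height_move[OF c p(1)] height_move[OF c q(1)] by (auto simp: movable_def)
    have "move a j q = move b i p"
    proof (rule columns_eqI)
      show "columns_within k (move a j q)" using a aq by (rule columns_within_move)
      show "columns_within k (move b i p)" using b bp by (rule columns_within_move)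
      show "height (move a j q) m x = height (move b i p) m x" for m x
        unfolding height_move[OF a aq] height_move[OF b bp]
        unfolding p(2) q(2) height_move[OF c p(1)] height_move[OF c q(1)]
        by (simp only: add_ac)
    qed
    then show ?thesis using stepI[OF aq] stepI[OF bp] by auto
  qed
qed

section \<open>Termination and unique normal forms\<close>

definition depth :: "nat \<Rightarrow> columns \<Rightarrow> nat" where
  "depth k c = (\<Sum>i<k. i * card (c i))"

text \<open>The highest weight condition. For columns aligned at the top it is the row condition of
  a tableau.\<close>

definition normal :: "columns \<Rightarrow> bool" where
  "normal c \<longleftrightarrow> (\<forall>i x. height c i x \<le> 0)"

lemma sum_lessThan_split_pair:
  fixes f :: "nat \<Rightarrow> 'a::comm_monoid_add"
  assumes "Suc i < k"
  shows "(\<Sum>m<k. f m) = f i + f (Suc i) + (\<Sum>m\<in>{..<k} - {i, Suc i}. f m)"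
proof -
  have "{..<k} = insert i (insert (Suc i) ({..<k} - {i, Suc i}))"
    using assms by auto
  then have "(\<Sum>m<k. f m) = sum f (insert i (insert (Suc i) ({..<k} - {i, Suc i})))"
    by simp
  then show ?thesis by (simp add: add.assoc)
qed

lemma depth_move:
  assumes "columns_within k c" "movable c i y"
  shows "depth k (move c i y) < depth k c"
proof -
  have "(\<Sum>m\<in>{..<k} - {i, Suc i}. m * card (move c i y m)) = (\<Sum>m\<in>{..<k} - {i, Suc i}. m * card (c m))"
    using card_move(3)[OF assms] by (intro sum.cong) auto
  then show ?thesis
    using card_move(1,2)[OF assms]
    unfolding depth_def sum_lessThan_split_pair[OF movable_mem(3)[OF assms]]
    by (auto simp: algebra_simps simp flip: card_move(2)[OF assms])
qed

lemma not_normal_step: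
  assumes "columns_within k c" "\<not> normal c"
  shows "\<exists>d. step c d"
  using assms movable_exists unfolding normal_def step_def by (metis not_le)

lemma normal_no_step:
  assumes "columns_within k c" "normal c"
  shows "\<not> step c d"
proof
  assume "step c d"
  then obtain i y where "movable c i y" by (auto simp: step_def)
  then have "height c i 0 < height c i y" by (auto simp: movable_def)
  then show False
    using height_0[OF assms(1), of i] assms(2) by (simp add: normal_def not_le[symmetric])
qed

lemma normal_form_exists:
  assumes "columns_within k c"
  shows "\<exists>n. step\<^sup>*\<^sup>* c n \<and> normal n"
  using assms
proof (induction "depth k c" arbitrary: c rule: less_induct)
  case less
  show ?case
  proof (cases "normal c")
    case False
    then obtain d where d: "step c d" using not_normal_step less.prems by blast
    then have "depth k d < depth k c"
      using depth_move less.prems by (auto simp: step_def)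
    then show ?thesis
      using less.hyps d step_within[OF less.prems d] by (meson converse_rtranclp_into_rtranclp)
  qed blast
qed

text \<open>Newman's argument, by induction on \<open>depth\<close>, which every move
  lowers.\<close>

lemma normal_form_unique:
  assumes "columns_within k c" "step\<^sup>*\<^sup>* c m" "normal m" "step\<^sup>*\<^sup>* c n" "normal n"
  shows "m = n"
  using assms
proof (induction "depth k c" arbitrary: c m n rule: less_induct)
  case less
  have stuck: "\<not> step c' d" if "step\<^sup>*\<^sup>* c c'" "normal c'" for c' d
    using normal_no_step steps_within less.prems(1) that by blast
  show ?case
  proof (cases "c = m \<or> c = n")
    case True
    then show ?thesis
      using less.prems stuck by (metis converse_rtranclpE rtranclp.rtrancl_refl)
  next
    case False
    then obtain a b where a: "step c a" "step\<^sup>*\<^sup>* a m" and b: "step c b" "step\<^sup>*\<^sup>* b n"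
      using less.prems by (metis converse_rtranclpE)
    have dec: "depth k a < depth k c" "depth k b < depth k c"
      using depth_move less.prems(1) a b by (auto simp: step_def)
    have within: "columns_within k a" "columns_within k b"
      using step_within less.prems(1) a b by auto
    obtain d where d: "step\<^sup>*\<^sup>* a d" "step\<^sup>*\<^sup>* b d"
      using step_locally_confluent less.prems(1) a b by blast
    obtain e where e: "step\<^sup>*\<^sup>* d e" "normal e"
      using normal_form_exists steps_within[OF d(1) within(1)] by blast
    have "m = e" "n = e"
      using less.hyps[OF dec(1) within(1) a(2)] less.hyps[OF dec(2) within(2) b(2)]
        less.prems d e by (meson rtranclp_trans)+
    then show ?thesis by simp
  qed
qed

definition normal_form :: "columns \<Rightarrow> columns" where
  "normal_form c = (SOME n. step\<^sup>*\<^sup>* c n \<and> normal n)"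

lemma normal_form:
  assumes "columns_within k c"
  shows "step\<^sup>*\<^sup>* c (normal_form c)" "normal (normal_form c)"
  using someI_ex[OF normal_form_exists[OF assms]] by (auto simp: normal_form_def)

lemma normal_form_eqI:
  assumes "columns_within k c" "step\<^sup>*\<^sup>* c n" "normal n"
  shows "normal_form c = n"
  using normal_form_unique normal_form assms by blast

lemma normal_form_step:
  assumes "columns_within k c" "step c d"
  shows "normal_form d = normal_form c"
  using normal_form[OF step_within[OF assms]] normal_form_eqI[OF assms(1)] assms(2)
  by (metis converse_rtranclp_into_rtranclp)

section \<open>Extremal tuples of columns\<close>

text \<open>
  Columns are read from bottom to top here.  Entries of the first column that are matched
  with an entry of the second one are lost, the unmatched ones are added to the second column.
\<close>

fun absorb :: "nat list \<Rightarrow> nat list \<Rightarrow> nat list" where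
  "absorb [] bs = bs"
| "absorb as [] = as"
| "absorb (a # as) (b # bs) =
     (if a \<le> b then b # absorb as bs else a # absorb as (b # bs))"

lemma absorb_Nil2 [simp]: "absorb as [] = as"
  by (cases as) auto

lemma set_absorb_subset: "set (absorb as bs) \<subseteq> set as \<union> set bs"
  by (induction as bs rule: absorb.induct) auto

lemma sorted_absorb:
  assumes "sorted_wrt (>) as" "sorted_wrt (>) bs"
  shows "sorted_wrt (>) (absorb as bs)"
  using assms
proof (induction as bs rule: absorb.induct)
  case (3 a as b bs)
  then show ?case
    using set_absorb_subset[of as bs] set_absorb_subset[of as "b # bs"] by fastforce
qed auto

section \<open>Absorption described by tail counts\<close>

definition excess :: "nat set \<Rightarrow> nat set \<Rightarrow> nat \<Rightarrow> int" where
  "excess A B y = int (card (A \<inter> {y..})) - int (card (B \<inter> {y..}))"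

text \<open>
  \<open>C\<close> consists of \<open>B\<close> and the members of \<open>A\<close> that stay unmatched when, from the largest
  member down, every member of \<open>A\<close> is matched with a remaining member of \<open>B\<close> that is not
  smaller.
\<close>

definition absorbs :: "nat set \<Rightarrow> nat set \<Rightarrow> nat set \<Rightarrow> bool" where
  "absorbs A B C \<longleftrightarrow> (\<forall>x. (\<forall>y\<ge>x. excess A B y \<le> excess C B x) \<and>
     (\<exists>y\<ge>x. excess A B y = excess C B x))"

lemma excess_insert_left:
  "finite A \<Longrightarrow> a \<notin> A \<Longrightarrow> excess (insert a A) B y = excess A B y + of_bool (y \<le> a)"
  by (simp add: excess_def Int_insert_left)

lemma excess_insert_right:
  "finite B \<Longrightarrow> b \<notin> B \<Longrightarrow> excess A (insert b B) y = excess A B y - of_bool (y \<le> b)"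
  by (simp add: excess_def Int_insert_left)

lemma excess_above:
  assumes "\<And>a. a \<in> A \<Longrightarrow> a < y" "\<And>b. b \<in> B \<Longrightarrow> b < y"
  shows "excess A B y = 0"
proof -
  have "A \<inter> {y..} = {}" "B \<inter> {y..} = {}"
    using assms by fastforce+
  then show ?thesis by (simp add: excess_def)
qed

lemma excess_nonpos:
  assumes "\<And>a. a \<in> A \<Longrightarrow> a < y"
  shows "excess A B y \<le> 0"
proof -
  have "A \<inter> {y..} = {}"
    using assms by fastforce
  then show ?thesis by (simp add: excess_def)
qed

lemma absorbs_nonneg:
  assumes "finite A" "finite B" "absorbs A B C"
  shows "0 \<le> excess C B x"
proof -
  obtain N where N: "\<forall>z\<in>A \<union> B. z \<le> N"
    using assms(1,2) finite_nat_set_iff_bounded_le by (metis finite_UnI)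
  have "excess A B (x + Suc N) = 0"
    using N by (intro excess_above) (auto simp: less_Suc_eq_le trans_le_add2)
  then show ?thesis
    using assms(3) unfolding absorbs_def by (metis le_add1)
qed

lemma absorbs_unique:
  assumes "absorbs A B C" "absorbs A B D" "finite C" "finite D"
  shows "C = D"
proof -
  have "excess C B x = excess D B x" for x
    using assms(1,2) unfolding absorbs_def by (metis order_antisym)
  then have eq: "card (C \<inter> {x..}) = card (D \<inter> {x..})" for x
    unfolding excess_def by simp
  have split: "card (E \<inter> {x..}) = card (E \<inter> {Suc x..}) + of_bool (x \<in> E)" if "finite E" for E x
  proof -
    have "E \<inter> {x..} = (if x \<in> E then insert x (E \<inter> {Suc x..}) else E \<inter> {Suc x..})"
      by (auto simp: Suc_le_eq less_le)
    then show ?thesis using that by simp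
  qed
  have "x \<in> C \<longleftrightarrow> x \<in> D" for x
    using eq[of x] eq[of "Suc x"] split[OF assms(3), of x] split[OF assms(4), of x]
    by (simp add: of_bool_eq_iff)
  then show ?thesis by blast
qed

text \<open>The number of unmatched members of the first column from \<open>x\<close> up is the
  largest excess over all tails that start at or above \<open>x\<close>. The induction follows the
  merge of the two lists.\<close>

lemma absorbs_set_absorb:
  assumes "sorted_wrt (>) as" "sorted_wrt (>) bs"
  shows "absorbs (set as) (set bs) (set (absorb as bs))"
  using assms
proof (induction as bs rule: absorb.induct)
  case (1 bs)
  have "\<exists>y\<ge>x. excess {} (set bs) y = 0" for x
  proof (intro exI conjI)
    show "x \<le> x + Suc (Max (insert 0 (set bs)))" by simp
    show "excess {} (set bs) (x + Suc (Max (insert 0 (set bs)))) = 0"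
      by (intro excess_above) (auto simp: less_Suc_eq_le trans_le_add2)
  qed
  moreover have "excess (set bs) (set bs) x = 0" for x
    by (simp add: excess_def)
  ultimately show ?case
    by (auto simp: absorbs_def intro!: excess_nonpos)
next
  case (2 a as)
  have "excess (set (a # as)) {} y \<le> excess (set (a # as)) {} x" if "x \<le> y" for x y
    using that unfolding excess_def by (auto intro!: card_mono)
  then show ?case by (auto simp: absorbs_def)
next
  case (3 a as b bs)
  let ?A = "set as" and ?B = "set bs"
  have A: "\<And>z. z \<in> ?A \<Longrightarrow> z < a" "a \<notin> ?A" and B: "\<And>z. z \<in> ?B \<Longrightarrow> z < b" "b \<notin> ?B"
    using "3.prems" by auto
  show ?case
  proof (cases "a \<le> b")
    case True
    let ?C = "set (absorb as bs)"
    have IH: "absorbs ?A ?B ?C"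
      using "3.IH"(1) True "3.prems" by simp
    have C: "b \<notin> ?C"
      using set_absorb_subset[of as bs] A B True by fastforce
    have eq1: "excess (insert a ?A) (insert b ?B) y
        = excess ?A ?B y + of_bool (y \<le> a) - of_bool (y \<le> b)" for y
      using A B by (simp add: excess_insert_left excess_insert_right)
    have eq2: "excess (insert b ?C) (insert b ?B) x = excess ?C ?B x" for x
      using B C by (simp add: excess_insert_left excess_insert_right)
    have "\<exists>y\<ge>x. excess (insert a ?A) (insert b ?B) y = excess ?C ?B x" for x
    proof -
      obtain y where y: "x \<le> y" "excess ?A ?B y = excess ?C ?B x"
        using IH by (auto simp: absorbs_def)
      show ?thesis
      \<comment> \<open>Adding both \<open>a\<close> and \<open>b\<close> lowers the excess only in
        the gap between them. No member of \<open>as\<close> reaches the gap, so a maximum attained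
        there is 0, and it is attained again above \<open>b\<close>, where both sides are
        empty.\<close>
      proof (cases "a < y \<and> y \<le> b")
        case True
        have "excess ?A ?B y \<le> 0"
          using A True by (intro excess_nonpos) fastforce
        then have "excess ?C ?B x = 0"
          using absorbs_nonneg[OF _ _ IH, of x] y by simp
        moreover have "excess ?A ?B (Suc b) = 0"
          using A B \<open>a \<le> b\<close> by (intro excess_above) fastforce+
        ultimately show ?thesis
          using True y \<open>a \<le> b\<close> by (intro exI[of _ "Suc b"]) (simp add: eq1)
      next
        case False
        then show ?thesis
          using y \<open>a \<le> b\<close> by (intro exI[of _ y]) (auto simp: eq1)
      qed
    qed
    moreover have "excess (insert a ?A) (insert b ?B) y \<le> excess ?C ?B x" if "x \<le> y" for x y
    proof -
      have "excess ?A ?B y \<le> excess ?C ?B x"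
        using IH that by (auto simp: absorbs_def)
      then show ?thesis using True by (auto simp: eq1)
    qed
    ultimately show ?thesis
      using True by (auto simp: absorbs_def eq2)
  next
    case False
    let ?B' = "insert b ?B" and ?C = "set (absorb as (b # bs))"
    have IH: "absorbs ?A ?B' ?C"
      using "3.IH"(2) False "3.prems" by simp
    have C: "a \<notin> ?C"
      using set_absorb_subset[of as "b # bs"] A B False by fastforce
    have eq1: "excess (insert a ?A) ?B' y = excess ?A ?B' y + of_bool (y \<le> a)" for y
      using A by (simp add: excess_insert_left)
    have eq2: "excess (insert a ?C) ?B' x = excess ?C ?B' x + of_bool (x \<le> a)" for x
      using C by (simp add: excess_insert_left)
    have "\<exists>y\<ge>x. excess (insert a ?A) ?B' y = excess ?C ?B' x + of_bool (x \<le> a)" for x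
    proof -
      obtain y where y: "x \<le> y" "excess ?A ?B' y = excess ?C ?B' x"
        using IH by (auto simp: absorbs_def)
      show ?thesis
      \<comment> \<open>A maximum attained above \<open>a\<close> is 0. Before \<open>a\<close> is
        added the excess at \<open>a\<close> is 0 too, and \<open>a\<close> is a place that gains
        the 1.\<close>
      proof (cases "x \<le> a \<and> a < y")
        case True
        have "excess ?A ?B' y = 0" "excess ?A ?B' a = 0"
          using A B True False by (intro excess_above; fastforce)+
        then show ?thesis
          using True y by (intro exI[of _ a]) (simp add: eq1)
      next
        case False
        then show ?thesis using y by (intro exI[of _ y]) (auto simp: eq1)
      qed
    qed
    moreover have "excess (insert a ?A) ?B' y \<le> excess ?C ?B' x + of_bool (x \<le> a)"
      if "x \<le> y" for x y
    proof -
      have "excess ?A ?B' y \<le> excess ?C ?B' x"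
        using IH that by (auto simp: absorbs_def)
      then show ?thesis using that by (auto simp: eq1)
    qed
    ultimately show ?thesis
      using False by (auto simp: absorbs_def eq2)
  qed
qed

text \<open>This is the second column at the end of the string of moves at which all unmatched
  entries of the pair are on the right.\<close>

definition absorb_set :: "nat set \<Rightarrow> nat set \<Rightarrow> nat set" where
  "absorb_set A B = set (absorb (rev (sorted_list_of_set A)) (rev (sorted_list_of_set B)))"

lemma sorted_rev_list_of_set: "sorted_wrt (>) (rev (sorted_list_of_set A))"
  by (simp add: sorted_wrt_rev)

lemma finite_absorb_set [simp]: "finite (absorb_set A B)"
  by (simp add: absorb_set_def)

lemma absorbs_absorb_set:
  assumes "finite A" "finite B"
  shows "absorbs A B (absorb_set A B)"
  using absorbs_set_absorb[OF sorted_rev_list_of_set sorted_rev_list_of_set, of A B] assms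
  by (simp add: absorb_set_def)

lemma absorb_set_eqI:
  assumes "finite A" "finite B" "finite C" "absorbs A B C"
  shows "absorb_set A B = C"
  using absorbs_unique[OF absorbs_absorb_set[OF assms(1,2)] assms(4)] assms(3) by simp

section \<open>Invariance of absorption under moves\<close>

text \<open>The tail from \<open>Suc x\<close> complements the prefix up to \<open>x\<close>, so
  excess and height differ by a constant.\<close>

lemma excess_Suc_eq_height:
  assumes "columns_within k c"
  shows "excess (c i) (c (Suc i)) (Suc x)
    = height c i x + int (card (c i)) - int (card (c (Suc i)))"
proof -
  have "int (card (c m \<inter> {Suc x..})) = int (card (c m)) - int (card (c m \<inter> {..x}))" for m
  proof -
    have "card (c m) = card (c m \<inter> {Suc x..} \<union> c m \<inter> {..x})"
      by (rule arg_cong[where f = card]) auto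
    also have "\<dots> = card (c m \<inter> {Suc x..}) + card (c m \<inter> {..x})"
      using assms by (intro card_Un_disjoint) (auto simp: columns_within_def)
    finally show ?thesis by simp
  qed
  then show ?thesis by (simp add: excess_def height_def)
qed

lemma excess_0:
  assumes "columns_within k c"
  shows "excess (c i) (c (Suc i)) 0 = excess (c i) (c (Suc i)) (Suc 0)"
  using excess_Suc_eq_height[OF assms, of i 0] height_0[OF assms, of i]
  by (simp add: excess_def atLeast_0)

lemma movable_excess:
  assumes c: "columns_within k c" and p: "movable c i p"
  shows "excess (c i) (c (Suc i)) y \<le> excess (c i) (c (Suc i)) (Suc p)"
    "y \<le> p \<Longrightarrow> excess (c i) (c (Suc i)) y < excess (c i) (c (Suc i)) (Suc p)"
    "excess (c i) (c (Suc i)) p = excess (c i) (c (Suc i)) (Suc p) - 1"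
proof -
  have h: "height c i x \<le> height c i p" "x < p \<Longrightarrow> height c i x < height c i p" for x
    using p by (auto simp: movable_def) (metis less_imp_le not_le)
  have pos: "0 < p" using p by (simp add: movable_def)
  then obtain r where r: "p = Suc r" by (cases p) auto
  show lt: "excess (c i) (c (Suc i)) y < excess (c i) (c (Suc i)) (Suc p)" if "y \<le> p" for y
  proof (cases y)
    case 0
    then show ?thesis
      using h(2)[OF pos] by (simp add: excess_0[OF c] excess_Suc_eq_height[OF c])
  next
    case (Suc x)
    then show ?thesis
      using h(2)[of x] that by (simp add: excess_Suc_eq_height[OF c])
  qed
  show "excess (c i) (c (Suc i)) y \<le> excess (c i) (c (Suc i)) (Suc p)"
  proof (cases "y \<le> p")
    case True
    then show ?thesis using lt[of y] by simp
  next
    case False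
    then obtain x where "y = Suc x" by (cases y) auto
    then show ?thesis using h(1)[of x] by (simp add: excess_Suc_eq_height[OF c])
  qed
  have "height c i (Suc r) \<le> height c i r + 1"
    using height_Suc[OF c, of i r] by simp
  then show "excess (c i) (c (Suc i)) p = excess (c i) (c (Suc i)) (Suc p) - 1"
    using h(2)[of r] unfolding r by (simp add: excess_Suc_eq_height[OF c])
qed

text \<open>The entry \<open>p\<close> was an unmatched member of the second column and becomes an
  unmatched member of the first, so the second column together with the unmatched entries of the
  first stays the same. In numbers: the overall maximum of the excess is attained at
  \<open>Suc p\<close>; up to \<open>p\<close> the excess was smaller and rises by 2, so the maximum
  over tails from \<open>x \<le> p\<close> rises by 1, with \<open>p\<close> as the place.\<close>

lemma absorbs_move:
  assumes c: "columns_within k c" and p: "movable c i p" and C: "absorbs (c i) (c (Suc i)) C"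
  shows "absorbs (move c i p i) (move c i p (Suc i)) C"
proof -
  let ?A = "c i" and ?B = "c (Suc i)"
  have fin: "finite ?A" "finite ?B" using c by (auto simp: columns_within_def)
  note mem = movable_mem[OF c p]
  have B: "excess E ?B y = excess E (?B - {p}) y - of_bool (y \<le> p)" for E y
    using excess_insert_right[of "?B - {p}" p E y] fin mem by (simp add: insert_absorb)
  have eq1: "excess (insert p ?A) (?B - {p}) y = excess ?A ?B y + 2 * of_bool (y \<le> p)" for y
    using excess_insert_left[OF fin(1) mem(2)] B[of ?A y] by simp
  have eq2: "excess C (?B - {p}) x = excess C ?B x + of_bool (x \<le> p)" for x
    using B[of C x] by simp
  note ex = movable_excess[OF c p]
  have le: "excess ?A ?B y \<le> excess C ?B x" if "x \<le> y" for x y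
    using C that by (auto simp: absorbs_def)
  have attained: "\<exists>y\<ge>x. excess ?A ?B y = excess C ?B x" for x
    using C by (auto simp: absorbs_def)
  have max: "excess C ?B x = excess ?A ?B (Suc p)" if "x \<le> p" for x
  proof (rule order_antisym)
    show "excess C ?B x \<le> excess ?A ?B (Suc p)"
      using attained[of x] ex(1) by metis
    show "excess ?A ?B (Suc p) \<le> excess C ?B x"
      using that by (intro le) simp
  qed
  have "excess (insert p ?A) (?B - {p}) y \<le> excess C (?B - {p}) x" if "x \<le> y" for x y
    unfolding eq1 eq2
    using le[OF that] ex(2)[of y] max[of x] that by (cases "x \<le> p"; cases "y \<le> p") auto
  moreover have "\<exists>y\<ge>x. excess (insert p ?A) (?B - {p}) y = excess C (?B - {p}) x" for x
  proof (cases "x \<le> p")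
    case True
    then show ?thesis
      unfolding eq1 eq2 using max[OF True] ex(3) by (intro exI[of _ p]) simp
  next
    case False
    obtain y where "x \<le> y" "excess ?A ?B y = excess C ?B x"
      using attained by blast
    then show ?thesis
      unfolding eq1 eq2 using False by (intro exI[of _ y]) simp
  qed
  ultimately show ?thesis by (simp add: absorbs_def move_def)
qed

lemma absorb_set_move:
  assumes c: "columns_within k c" and p: "movable c i p"
  shows "absorb_set (move c i p i) (move c i p (Suc i)) = absorb_set (c i) (c (Suc i))"
proof (rule absorb_set_eqI)
  show "finite (move c i p i)" "finite (move c i p (Suc i))"
    using columns_within_move[OF c p] by (auto simp: columns_within_def)
  show "absorbs (move c i p i) (move c i p (Suc i)) (absorb_set (c i) (c (Suc i)))"
    using c by (intro absorbs_move[OF c p] absorbs_absorb_set) (auto simp: columns_within_def)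
qed simp

text \<open>The bound says that the final height is maximal, that is, every entry of the first
  column has a partner and nothing is added to the second.\<close>

lemma absorb_set_eq_right:
  assumes c: "columns_within k c"
    and h: "\<And>x. height c i x \<le> int (card (c (Suc i))) - int (card (c i))"
  shows "absorb_set (c i) (c (Suc i)) = c (Suc i)"
proof (rule absorb_set_eqI)
  show fin: "finite (c i)" "finite (c (Suc i))" "finite (c (Suc i))"
    using c by (auto simp: columns_within_def)
  have le: "excess (c i) (c (Suc i)) y \<le> 0" for y
    using h[of "y - 1"] h[of 0] excess_0[OF c, of i]
    by (cases y) (simp_all add: excess_Suc_eq_height[OF c])
  obtain N where N: "\<And>m. c m \<subseteq> {..N}"
    using columns_bounded[OF c] by blast
  have "excess (c i) (c (Suc i)) (x + Suc N) = 0" for x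
    using N[of i] N[of "Suc i"] by (intro excess_above) (auto simp: less_Suc_eq_le trans_le_add2)
  then have "\<exists>y\<ge>x. excess (c i) (c (Suc i)) y = 0" for x
    by (intro exI[of _ "x + Suc N"]) simp
  then show "absorbs (c i) (c (Suc i)) (c (Suc i))"
    using le by (auto simp: absorbs_def excess_def[of "c (Suc i)" "c (Suc i)"])
qed

text \<open>Just before the moved entry the height is at least the maximum minus 1, and the move
  does not affect it. A height of \<open>r\<close> therefore leaves room for \<open>r\<close>
  moves.\<close>

lemma steps_in_pair:
  assumes "columns_within k c" "int r \<le> height c i x"
  shows "\<exists>d. columns_within k d \<and> normal_form d = normal_form c \<and>
    card (d i) = card (c i) + r \<and> card (d (Suc i)) + r = card (c (Suc i)) \<and>
    (\<forall>m. m \<noteq> i \<longrightarrow> m \<noteq> Suc i \<longrightarrow> d m = c m) \<and>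
    absorb_set (d i) (d (Suc i)) = absorb_set (c i) (c (Suc i))"
  using assms
proof (induction r arbitrary: c x)
  case 0
  then show ?case by (intro exI[of _ c]) auto
next
  case (Suc r)
  have "0 < height c i x" using Suc.prems(2) by simp
  then obtain y where y: "movable c i y" "\<And>z. height c i z \<le> height c i y"
    using movable_exists[OF Suc.prems(1)] by blast
  let ?c = "move c i y"
  have within: "columns_within k ?c"
    using columns_within_move Suc.prems(1) y(1) .
  obtain s where s: "y = Suc s" using y(1) by (cases y) (auto simp: movable_def)
  have "height c i y \<le> height c i s + 1"
    using height_Suc[OF Suc.prems(1), of i s] s by simp
  then have "int r \<le> height ?c i s"
    using height_move[OF Suc.prems(1) y(1), of i s] y(2)[of x] Suc.prems(2) s by simp
  from Suc.IH[OF within this] obtain d where d: "columns_within k d"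
    "normal_form d = normal_form ?c" "card (d i) = card (?c i) + r"
    "card (d (Suc i)) + r = card (?c (Suc i))"
    "\<forall>m. m \<noteq> i \<longrightarrow> m \<noteq> Suc i \<longrightarrow> d m = ?c m"
    "absorb_set (d i) (d (Suc i)) = absorb_set (?c i) (?c (Suc i))"
    by blast
  moreover have "normal_form ?c = normal_form c"
    using normal_form_step[OF Suc.prems(1) stepI[OF y(1)]] .
  ultimately show ?case
    using card_move[OF Suc.prems(1) y(1)] absorb_set_move[OF Suc.prems(1) y(1)]
    by (intro exI[of _ d]) auto
qed

section \<open>Square sums, extremal weights and reflections\<close>

definition square_sum :: "nat \<Rightarrow> columns \<Rightarrow> nat" where
  "square_sum k c = (\<Sum>i<k. card (c i) ^ 2)"

lemma square_sum_pair:
  assumes "Suc i < k" "\<forall>m. m \<noteq> i \<longrightarrow> m \<noteq> Suc i \<longrightarrow> d m = c m"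
  shows "square_sum k d + card (c i) ^ 2 + card (c (Suc i)) ^ 2
    = square_sum k c + card (d i) ^ 2 + card (d (Suc i)) ^ 2"
proof -
  have "(\<Sum>m\<in>{..<k} - {i, Suc i}. card (d m) ^ 2) = (\<Sum>m\<in>{..<k} - {i, Suc i}. card (c m) ^ 2)"
    using assms(2) by (intro sum.cong) auto
  then show ?thesis
    unfolding square_sum_def sum_lessThan_split_pair[OF assms(1)] by simp
qed

lemma depth_pair:
  assumes "Suc i < k" "\<forall>m. m \<noteq> i \<longrightarrow> m \<noteq> Suc i \<longrightarrow> d m = c m"
    and "card (d i) = card (c i) + r" "card (d (Suc i)) + r = card (c (Suc i))" "0 < r"
  shows "depth k d < depth k c"
proof -
  have "(\<Sum>m\<in>{..<k} - {i, Suc i}. m * card (d m)) = (\<Sum>m\<in>{..<k} - {i, Suc i}. m * card (c m))"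
    using assms(2) by (intro sum.cong) auto
  then show ?thesis
    using assms(3,5)
    unfolding depth_def sum_lessThan_split_pair[OF assms(1)]
    by (simp add: algebra_simps flip: assms(4))
qed

lemma square_sum_le_normal_form:
  assumes "columns_within k c"
  shows "square_sum k c \<le> square_sum k (normal_form c)"
  using assms
proof (induction "depth k c" arbitrary: c rule: less_induct)
  case less
  show ?case
  proof (cases "normal c")
    case True
    then show ?thesis using normal_form_eqI[OF less.prems _ True] by simp
  next
    case False
    then obtain i x where x: "0 < height c i x"
      by (auto simp: normal_def not_le)
    then have "Suc i < k"
      using movable_exists[OF less.prems] movable_mem(3)[OF less.prems] by metis
    \<comment> \<open>A single move may make two lengths more equal and lower the square sum. If the
      second column is longer, as many moves as the difference exchange the lengths instead;
      otherwise one move makes them more unequal.\<close>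
    define r where "r = max 1 (card (c (Suc i)) - card (c i))"
    have "\<exists>x. int r \<le> height c i x"
    proof (cases "card (c (Suc i)) \<le> Suc (card (c i))")
      case True
      then have "r = 1" unfolding r_def by simp
      then show ?thesis using x by (intro exI[of _ x]) simp
    next
      case False
      obtain N where "\<And>m. c m \<subseteq> {..N}" using columns_bounded[OF less.prems] by blast
      then have "height c i N = int (card (c (Suc i))) - int (card (c i))"
        by (rule height_eq_card_diff) simp
      then show ?thesis using False by (intro exI[of _ N]) (simp add: r_def)
    qed
    then obtain d where d: "columns_within k d" "normal_form d = normal_form c"
      "card (d i) = card (c i) + r" "card (d (Suc i)) + r = card (c (Suc i))"
      "\<forall>m. m \<noteq> i \<longrightarrow> m \<noteq> Suc i \<longrightarrow> d m = c m"
      using steps_in_pair[OF less.prems] by blast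
    have "0 < r" by (simp add: r_def)
    have "card (d (Suc i)) \<le> card (c i)"
      using d(4) unfolding r_def by linarith
    then have "card (c i) ^ 2 + card (c (Suc i)) ^ 2 \<le> card (d i) ^ 2 + card (d (Suc i)) ^ 2"
      unfolding d(3) d(4)[symmetric] by (simp add: power2_sum) 
    then have "square_sum k c \<le> square_sum k d"
      using square_sum_pair[OF \<open>Suc i < k\<close> d(5)] by simp
    also have "\<dots> \<le> square_sum k (normal_form d)"
      using depth_pair[OF \<open>Suc i < k\<close> d(5,3,4) \<open>0 < r\<close>] d(1) by (rule less.hyps)
    finally show ?thesis by (simp add: d(2))
  qed
qed

text \<open>All tuples of a component share the normal form and none has a larger square sum, so the
  inequality says that the maximum is attained.\<close>

definition extremal :: "nat \<Rightarrow> columns \<Rightarrow> bool" where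
  "extremal k c \<longleftrightarrow> columns_within k c \<and> square_sum k (normal_form c) \<le> square_sum k c"

text \<open>With a larger height, \<open>r + 1\<close> moves would go beyond the exchange of the two
  lengths and leave them more unequal than before, which would raise the maximal square sum.\<close>

lemma extremal_height_le:
  assumes c: "extremal k c" and i: "Suc i < k"
    and r: "int (card (c (Suc i))) - int (card (c i)) \<le> int r"
  shows "height c i x \<le> int r"
proof (rule ccontr)
  assume "\<not> ?thesis"
  then have "int (Suc r) \<le> height c i x" by simp
  then obtain d where d: "columns_within k d" "normal_form d = normal_form c"
      "card (d i) = card (c i) + Suc r" "card (d (Suc i)) + Suc r = card (c (Suc i))"
      "\<forall>m. m \<noteq> i \<longrightarrow> m \<noteq> Suc i \<longrightarrow> d m = c m"
    using steps_in_pair[of k c "Suc r"] c by (metis extremal_def)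
  have "card (d (Suc i)) < card (c i)"
    using d(4) r by linarith
  then have "card (d (Suc i)) * Suc r < card (c i) * Suc r" by (rule mult_less_mono1) simp
  then have "card (c i) ^ 2 + card (c (Suc i)) ^ 2 < card (d i) ^ 2 + card (d (Suc i)) ^ 2"
    unfolding d(3) d(4)[symmetric] power2_sum by simp
  then have "square_sum k c < square_sum k d"
    using square_sum_pair[OF i d(5)] by simp
  also have "\<dots> \<le> square_sum k (normal_form c)"
    using square_sum_le_normal_form[OF d(1)] d(2) by simp
  finally show False using c by (simp add: extremal_def)
qed

lemma extremal_normalI:
  assumes c: "extremal k c" and sorted: "\<And>i. Suc i < k \<Longrightarrow> card (c (Suc i)) \<le> card (c i)"
  shows "normal c"
  unfolding normal_def
proof (intro allI)
  fix i x
  show "height c i x \<le> 0"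
  proof (cases "Suc i < k")
    case True
    then show ?thesis using extremal_height_le[OF c True, of 0] sorted[OF True] by simp
  next
    case False
    then show ?thesis using c by (simp add: height_def extremal_def columns_within_def)
  qed
qed

text \<open>The Weyl group reflection. The moves exchange the two lengths and keep what the pair
  absorbs to. By extremality all entries of the shorter column \<open>c i\<close> are matched, so
  this is \<open>c (Suc i)\<close>.\<close>

lemma extremal_swap_left:
  assumes c: "extremal k c" and i: "Suc i < k" and less: "card (c i) < card (c (Suc i))"
  obtains d where "extremal k d" "normal_form d = normal_form c"
    "card (d i) = card (c (Suc i))" "card (d (Suc i)) = card (c i)"
    "\<And>m. m \<noteq> i \<Longrightarrow> m \<noteq> Suc i \<Longrightarrow> d m = c m"
    "absorb_set (d i) (d (Suc i)) = c (Suc i)" "depth k d < depth k c"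
proof -
  have within: "columns_within k c" using c by (simp add: extremal_def)
  define r where "r = card (c (Suc i)) - card (c i)"
  obtain N where "\<And>m. c m \<subseteq> {..N}" using columns_bounded[OF within] by blast
  then have "height c i N = int (card (c (Suc i))) - int (card (c i))"
    by (rule height_eq_card_diff) simp
  then have "int r \<le> height c i N" using less by (simp add: r_def)
  from steps_in_pair[OF within this] obtain d where d: "columns_within k d"
    "normal_form d = normal_form c"
    "card (d i) = card (c i) + r" "card (d (Suc i)) + r = card (c (Suc i))"
    "\<forall>m. m \<noteq> i \<longrightarrow> m \<noteq> Suc i \<longrightarrow> d m = c m"
    "absorb_set (d i) (d (Suc i)) = absorb_set (c i) (c (Suc i))"
    by blast
  have cards: "card (d i) = card (c (Suc i))" "card (d (Suc i)) = card (c i)"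
    using d(3,4) less by (auto simp: r_def)
  have "absorb_set (c i) (c (Suc i)) = c (Suc i)"
    using extremal_height_le[OF c i, of r] less
    by (intro absorb_set_eq_right[OF within]) (simp add: r_def)
  moreover have "extremal k d"
    using square_sum_pair[OF i d(5)] c d(1,2) cards by (simp add: extremal_def)
  moreover have "depth k d < depth k c"
    using depth_pair[OF i d(5,3,4)] less by (simp add: r_def)
  ultimately show thesis
    using that[of d] d cards by simp
qed

section \<open>Passing a column through the columns to its right\<close>

definition absorb_from :: "nat \<Rightarrow> columns \<Rightarrow> nat \<Rightarrow> nat set" where
  "absorb_from k c p = foldl absorb_set (c p) (map c [Suc p..<k])"

lemma absorb_from_cong:
  "(\<And>m. p \<le> m \<Longrightarrow> c m = d m) \<Longrightarrow> absorb_from k c p = absorb_from k d p"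
  unfolding absorb_from_def by (intro arg_cong2[where f = "foldl absorb_set"] map_cong) auto

lemma absorb_from_Suc:
  assumes "Suc p < k" "absorb_set (d p) (d (Suc p)) = c (Suc p)"
    and "\<And>m. Suc p < m \<Longrightarrow> d m = c m"
  shows "absorb_from k d p = absorb_from k c (Suc p)"
proof -
  have "map d [Suc p..<k] = d (Suc p) # map c [Suc (Suc p)..<k]"
    using assms(1,3) by (auto simp: upt_conv_Cons)
  then show ?thesis by (simp add: absorb_from_def assms(2))
qed

text \<open>
  The columns before \<open>p\<close> are sorted first, then column \<open>p\<close> is moved to the left.
\<close>

lemma absorb_from_normal_form:
  assumes "extremal k c" "p < k"
    and "\<And>l. p < l \<Longrightarrow> l < k \<Longrightarrow> card (c l) \<le> card (c p)"
    and "\<And>l. p < l \<Longrightarrow> Suc l < k \<Longrightarrow> card (c (Suc l)) \<le> card (c l)"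
    and "\<And>j l. j < p \<Longrightarrow> p < l \<Longrightarrow> l < k \<Longrightarrow> card (c l) \<le> card (c j)"
  shows "\<exists>q<k. card (normal_form c q) = card (c p) \<and>
    absorb_from k (normal_form c) q = absorb_from k c p"
  using assms
proof (induction "depth k c" arbitrary: c p rule: less_induct)
  case less
  note c = less.prems
  consider (before) i where "Suc i < p" "card (c i) < card (c (Suc i))"
    | (at) i where "Suc i = p" "card (c i) < card (c p)"
        "\<And>i. Suc i < p \<Longrightarrow> card (c (Suc i)) \<le> card (c i)"
    | (sorted) "\<And>i. Suc i \<le> p \<Longrightarrow> card (c (Suc i)) \<le> card (c i)"
    by (metis le_neq_implies_less not_le)
  then show ?case
  proof cases
    case before
    then have "Suc i < k" using c(2) by simp
    from extremal_swap_left[OF c(1) this before(2)] obtain d where d: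
      "extremal k d" "normal_form d = normal_form c"
      "card (d i) = card (c (Suc i))" "card (d (Suc i)) = card (c i)"
      "\<And>m. m \<noteq> i \<Longrightarrow> m \<noteq> Suc i \<Longrightarrow> d m = c m" "depth k d < depth k c"
      by metis
    have same: "d m = c m" if "p \<le> m" for m
      using d(5)[of m] that before(1) by simp
    have "\<exists>q<k. card (normal_form d q) = card (d p) \<and>
        absorb_from k (normal_form d) q = absorb_from k d p"
    proof (rule less.hyps[OF d(6) d(1) c(2)])
      fix j l assume "j < p" "p < l" "l < k"
      then show "card (d l) \<le> card (d j)"
        using c(5)[of j l] c(5)[of i l] c(5)[of "Suc i" l] before(1) d(3,4) d(5)[of j] same[of l]
        by (cases "j = i"; cases "j = Suc i") auto
    qed (use same c in auto)
    then show ?thesis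
      using absorb_from_cong[of p d c k] same d(2) by auto
  next
    case at
    have "Suc i < k" using c(2) at(1) by simp
    from extremal_swap_left[OF c(1) this] at(1,2) obtain d where d:
      "extremal k d" "normal_form d = normal_form c"
      "card (d i) = card (c p)" "card (d p) = card (c i)"
      "\<And>m. m \<noteq> i \<Longrightarrow> m \<noteq> p \<Longrightarrow> d m = c m" "depth k d < depth k c"
      "absorb_set (d i) (d p) = c p"
      by metis
    \<comment> \<open>The length of column \<open>i\<close> ends up at \<open>p\<close>, to the
      right of the column that is followed from now on. The induction hypothesis wants it to be at
      most every length further left.\<close>
    have mono: "card (c i) \<le> card (c j)" if "j \<le> i" for j
      using that
    proof (induction rule: inc_induct)
      case (step n)
      then show ?case using at(1) at(3)[of n] by simp
    qed simp
    have "\<exists>q<k. card (normal_form d q) = card (d i) \<and>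
        absorb_from k (normal_form d) q = absorb_from k d i"
    proof (rule less.hyps[OF d(6) d(1)])
      show "i < k" using \<open>Suc i < k\<close> by simp
      show "card (d l) \<le> card (d i)" if "i < l" "l < k" for l
        using that c(3)[of l] d(3,4) d(5)[of l] at(1,2) by (cases "l = p") auto
      show "card (d (Suc l)) \<le> card (d l)" if "i < l" "Suc l < k" for l
        using that c(4)[of l] c(5)[of i "Suc l"] d(4) d(5)[of l] d(5)[of "Suc l"] at(1)
        by (cases "l = p") auto
      show "card (d l) \<le> card (d j)" if "j < i" "i < l" "l < k" for j l
        using that c(5)[of j l] mono[of j] d(4) d(5)[of l] d(5)[of j] at(1)
        by (cases "l = p") auto
    qed
    \<comment> \<open>The extra absorption of \<open>d i\<close> into \<open>d p\<close> gives
      \<open>c p\<close>; this undoes the exchange.\<close>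
    moreover have "absorb_from k d i = absorb_from k c p"
      using absorb_from_Suc[of i k d c] \<open>Suc i < k\<close> at(1) d(5,7) by simp
    ultimately show ?thesis using d(2,3) by auto
  next
    case sorted
    have "card (c (Suc i)) \<le> card (c i)" if "Suc i < k" for i
      using that sorted[of i] c(3)[of "Suc i"] c(4)[of i]
      by (cases "Suc i \<le> p"; cases "i = p") auto
    then have "normal c" using extremal_normalI[OF c(1)] by blast
    then have "normal_form c = c"
      using normal_form_eqI[of k c c] c(1) by (simp add: extremal_def)
    then show ?thesis using c(2) by auto
  qed
qed

lemma normal_card_mono:
  assumes c: "columns_within k c" and "normal c" and "i \<le> j"
  shows "card (c j) \<le> card (c i)"
  using \<open>i \<le> j\<close>
proof (induction rule: dec_induct)
  case (step j)
  obtain N where N: "\<And>m. c m \<subseteq> {..N}" using columns_bounded[OF c] by blast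
  have "height c j N \<le> 0" using \<open>normal c\<close> by (simp add: normal_def)
  then show ?case using height_eq_card_diff[of c N N j, OF N] step by simp
qed simp

text \<open>In a normal tuple a column is completely matched with the next one of the same length
  and absorbs to it. Which of several equally long columns is taken makes no difference.\<close>

lemma absorb_from_equal_card:
  assumes c: "columns_within k c" and "normal c" and "i \<le> j" "j < k" "card (c i) = card (c j)"
  shows "absorb_from k c i = absorb_from k c j"
  using assms(3-)
proof (induction rule: inc_induct)
  case (step n)
  have "card (c n) = card (c (Suc n))" "card (c (Suc n)) = card (c j)"
    using normal_card_mono[OF c \<open>normal c\<close>, of n "Suc n"]
      normal_card_mono[OF c \<open>normal c\<close>, of "Suc n" j] step by auto
  moreover from this have "absorb_set (c n) (c (Suc n)) = c (Suc n)"
    using \<open>normal c\<close> by (intro absorb_set_eq_right[OF c]) (simp add: normal_def)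
  then have "absorb_from k c n = absorb_from k c (Suc n)"
    using step by (intro absorb_from_Suc) auto
  ultimately show ?case using step by simp
qed simp

theorem extremal_last_column:
  assumes c: "extremal k c" and i: "i < k" and card: "card (c (k - 1)) = card (normal_form c i)"
  shows "c (k - 1) = absorb_from k (normal_form c) i"
proof -
  have within: "columns_within k c" using c by (simp add: extremal_def)
  let ?n = "normal_form c"
  have n: "columns_within k ?n" "normal ?n"
    using normal_form[OF within] steps_within within by auto
  \<comment> \<open>For \<open>p = k - 1\<close> the conditions on later columns are
    vacuous.\<close>
  have "\<exists>q<k. card (?n q) = card (c (k - 1)) \<and> absorb_from k ?n q = absorb_from k c (k - 1)"
    using i by (intro absorb_from_normal_form[OF c]) auto
  then obtain q where q: "q < k" "card (?n q) = card (?n i)"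
    "absorb_from k ?n q = absorb_from k c (k - 1)"
    using card by auto
  have "absorb_from k ?n q = absorb_from k ?n i"
    using absorb_from_equal_card[OF n] q i by (metis nat_le_linear)
  moreover have "absorb_from k c (k - 1) = c (k - 1)"
    using i by (simp add: absorb_from_def)
  ultimately show ?thesis using q(3) by simp
qed

section \<open>Inverse moves and rotated column lengths\<close>

text \<open>The entry to move back follows directly on the last maximum of the height. The strict
  bound keeps the maximum from lasting to the end, so the height drops there.\<close>

lemma unmove_exists:
  assumes c: "columns_within k c" and i: "Suc i < k"
    and x: "int (card (c (Suc i))) - int (card (c i)) < height c i x"
  obtains d y where "columns_within k d" "movable d i y" "c = move d i y"
    "height c i x < height d i y"
proof -
  obtain N where N: "\<And>m. c m \<subseteq> {..N}" using columns_bounded[OF c] by blast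
  have fin: "finite (height c i ` {..N})" by simp
  define m where "m = Max (height c i ` {..N})"
  have large: "height c i z < m" if "N < z" for z
  proof -
    have "height c i x \<le> m"
    proof (cases "x \<le> N")
      case True
      then show ?thesis unfolding m_def by (intro Max_ge[OF fin]) auto
    next
      case False
      then show ?thesis using x height_eq_card_diff[of c N x i, OF N] by simp
    qed
    then show ?thesis using x height_eq_card_diff[of c N z i, OF N] that by simp
  qed
  have le: "height c i z \<le> m" for z
  proof (cases "z \<le> N")
    case True
    then show ?thesis unfolding m_def by (intro Max_ge[OF fin]) auto
  next
    case False
    then show ?thesis using large[of z] by simp
  qed
  have "m \<in> height c i ` {..N}"
    unfolding m_def by (rule Max_in) auto
  then obtain z0 where z0: "height c i z0 = m" by blast
  have bound: "\<forall>z. height c i z = m \<longrightarrow> z \<le> N"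
    using large by (metis less_irrefl not_le)
  define s where "s = (GREATEST z. height c i z = m)"
  have s: "height c i s = m"
    unfolding s_def using GreatestI_nat[of "\<lambda>z. height c i z = m" z0 N] z0 bound by blast
  have lt: "height c i z < m" if "s < z" for z
    using Greatest_le_nat[of "\<lambda>z. height c i z = m" z N] bound that le[of z]
    unfolding s_def by force
  define y where "y = Suc s"
  have step: "height c i y = m + of_bool (y \<in> c (Suc i)) - of_bool (y \<in> c i)"
    using height_Suc[OF c, of i s] s by (simp add: y_def)
  have y: "y \<in> c i" "y \<notin> c (Suc i)"
    using step lt[of y] by (auto simp: y_def split: if_splits)
  define d where "d = c(i := c i - {y}, Suc i := insert y (c (Suc i)))"
  have finc: "finite (c l)" for l using c by (simp add: columns_within_def)
  have within: "columns_within k d"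
    using c i by (auto simp: columns_within_def d_def y_def)
  have h: "height d i z = height c i z + 2 * of_bool (y \<le> z)" for z
    using card_insert_Int_atMost[OF finc y(2), of z] card_remove_Int_atMost[OF finc y(1), of z]
    by (simp add: height_def d_def)
  have hy: "height d i y = m + 1"
    using h[of y] step y by simp
  have "movable d i y"
  proof (rule movableI)
    show "0 < y" by (simp add: y_def)
    show "height d i z < height d i y" if "z < y" for z
      using le[of z] that hy h[of z] by simp
    show "height d i z \<le> height d i y" if "y \<le> z" for z
      using lt[of z] that hy h[of z] by (simp add: y_def)
  qed
  moreover have "c = move d i y"
    using y by (simp add: move_def d_def insert_absorb fun_eq_iff)
  moreover have "height c i x < height d i y"
    using le[of x] hy by simp
  ultimately show thesis using that within by blast
qed

text \<open>The maximal height exceeds the final one, which is the difference of the lengths, by the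
  number of unmatched entries of column \<open>i\<close>. The bound provides \<open>r\<close> of
  them.\<close>

lemma swap_right:
  assumes "columns_within k c" "Suc i < k"
    and "int (card (c (Suc i))) - int (card (c i)) + int r \<le> height c i x"
  shows "\<exists>d. columns_within k d \<and> normal_form d = normal_form c \<and>
    card (d i) + r = card (c i) \<and> card (d (Suc i)) = card (c (Suc i)) + r \<and>
    (\<forall>m. m \<noteq> i \<longrightarrow> m \<noteq> Suc i \<longrightarrow> d m = c m)"
  using assms
proof (induction r arbitrary: c x)
  case 0
  then show ?case by (intro exI[of _ c]) auto
next
  case (Suc r)
  have "int (card (c (Suc i))) - int (card (c i)) < height c i x" using Suc.prems(3) by simp
  from unmove_exists[OF Suc.prems(1,2) this] obtain b y where b: "columns_within k b"
    "movable b i y" "c = move b i y" "height c i x < height b i y" by blast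
  have cards: "card (c i) = Suc (card (b i))" "Suc (card (c (Suc i))) = card (b (Suc i))"
    "\<And>m. m \<noteq> i \<Longrightarrow> m \<noteq> Suc i \<Longrightarrow> c m = b m"
    using card_move[OF b(1,2)] unfolding b(3) by auto
  have "int (card (b (Suc i))) - int (card (b i)) + int r \<le> height b i y"
    using Suc.prems(3) b(4) cards(1,2) by linarith
  from Suc.IH[OF b(1) Suc.prems(2) this] obtain d where d: "columns_within k d"
    "normal_form d = normal_form b" "card (d i) + r = card (b i)"
    "card (d (Suc i)) = card (b (Suc i)) + r" "\<forall>m. m \<noteq> i \<longrightarrow> m \<noteq> Suc i \<longrightarrow> d m = b m"
    by blast
  moreover have "normal_form c = normal_form b"
    using normal_form_step[OF b(1) stepI[OF b(2)]] unfolding b(3) .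
  moreover have "card (d i) + Suc r = card (c i)" "card (d (Suc i)) = card (c (Suc i)) + Suc r"
    using d(3,4) cards(1,2) by linarith+
  moreover have "\<forall>m. m \<noteq> i \<longrightarrow> m \<noteq> Suc i \<longrightarrow> d m = c m"
    using d(5) cards(3) by metis
  ultimately show ?case by metis
qed

text \<open>For \<open>p = k - 1\<close> this yields the lengths of a tableau with the
  \<open>i\<close>-th one moved to the end, as a frank skew tableau for the \<open>i\<close>-th key
  column has them. Lengths of a normal tuple decrease weakly, so every exchange moves entries to the
  right.\<close>

lemma push_right:
  assumes c: "columns_within k c" "normal c" and "i \<le> p" "p < k"
  shows "\<exists>d. columns_within k d \<and> normal_form d = c \<and>
    (\<forall>j<i. card (d j) = card (c j)) \<and>
    (\<forall>j. i \<le> j \<longrightarrow> j < p \<longrightarrow> card (d j) = card (c (Suc j))) \<and>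
    card (d p) = card (c i) \<and> (\<forall>j>p. d j = c j)"
  using \<open>i \<le> p\<close> \<open>p < k\<close>
proof (induction p rule: dec_induct)
  case base
  have "normal_form c = c"
    using normal_form_eqI[of k c c] c by simp
  then show ?case using c by (intro exI[of _ c]) auto
next
  case (step p)
  then obtain d where d: "columns_within k d" "normal_form d = c"
    "\<forall>j<i. card (d j) = card (c j)"
    "\<forall>j. i \<le> j \<longrightarrow> j < p \<longrightarrow> card (d j) = card (c (Suc j))"
    "card (d p) = card (c i)" "\<forall>j>p. d j = c j"
    by auto
  have le: "card (d (Suc p)) \<le> card (d p)"
    using normal_card_mono[OF c, of i "Suc p"] d(5,6) step.hyps by simp
  \<comment> \<open>With the difference of the lengths as \<open>r\<close>, the bound in
    \<open>swap_right\<close> becomes 0, the height at 0.\<close>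
  then have "int (card (d (Suc p))) - int (card (d p)) + int (card (d p) - card (d (Suc p)))
      \<le> height d p 0"
    using height_0[OF d(1)] by simp
  from swap_right[OF d(1) step.prems this] obtain e where e: "columns_within k e"
    "normal_form e = normal_form d"
    "card (e p) + (card (d p) - card (d (Suc p))) = card (d p)"
    "card (e (Suc p)) = card (d (Suc p)) + (card (d p) - card (d (Suc p)))"
    "\<forall>m. m \<noteq> p \<longrightarrow> m \<noteq> Suc p \<longrightarrow> e m = d m"
    by blast
  have "card (e p) = card (c (Suc p))" "card (e (Suc p)) = card (c i)"
    using e(3,4) le d(5,6) by auto
  then show ?case
    using e d step.hyps by (intro exI[of _ e]) (auto simp: less_Suc_eq)
qed

section \<open>Jeu de taquin slides as raising operators\<close>

definition filling_columns :: "(box \<Rightarrow> nat option) \<Rightarrow> columns" where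
  "filling_columns f i = {x. \<exists>j. f (i, j) = Some x}"

definition ordered_filling :: "(box \<Rightarrow> nat option) \<Rightarrow> bool" where
  "ordered_filling f \<longleftrightarrow> (\<forall>x\<in>ran f. 0 < x) \<and>
     (\<forall>i j j' x y. j < j' \<and> f (i, j) = Some x \<and> f (i, j') = Some y \<longrightarrow> x < y) \<and>
     (\<forall>i i' j x y. i < i' \<and> f (i, j) = Some x \<and> f (i', j) = Some y \<longrightarrow> x \<le> y)"

lemma ordered_fillingD:
  assumes "ordered_filling f"
  shows "f b = Some x \<Longrightarrow> 0 < x"
    "f (i, j) = Some x \<Longrightarrow> f (i, j') = Some y \<Longrightarrow> j < j' \<Longrightarrow> x < y"
    "f (i, j) = Some x \<Longrightarrow> f (i', j) = Some y \<Longrightarrow> i < i' \<Longrightarrow> x \<le> y"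
  using assms unfolding ordered_filling_def by (auto intro: ranI)

lemma ordered_filling_column_inj:
  assumes "ordered_filling f" "f (i, j) = Some x" "f (i, j') = Some x"
  shows "j = j'"
  using ordered_fillingD(2)[OF assms(1,2,3)] ordered_fillingD(2)[OF assms(1,3,2)]
  by (metis less_irrefl linorder_neqE_nat)

text \<open>Passing to the neighbour in the same row is injective, because an entry determines its
  row within a column. This turns row conditions into inequalities between heights.\<close>

lemma card_filling_columns_le:
  assumes f: "ordered_filling f" and "finite W"
    and ex: "\<And>j a. f (u, j) = Some a \<Longrightarrow> a \<in> V \<Longrightarrow> \<exists>b. f (v, j) = Some b \<and> b \<in> W"
  shows "card (filling_columns f u \<inter> V) \<le> card (filling_columns f v \<inter> W)"
proof -
  define row where "row a = (SOME j. f (u, j) = Some a)" for a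
  define g where "g a = the (f (v, row a))" for a
  have row: "f (u, row a) = Some a" if "a \<in> filling_columns f u" for a
    using that someI_ex[of "\<lambda>j. f (u, j) = Some a"] by (simp add: filling_columns_def row_def)
  have g: "f (v, row a) = Some (g a) \<and> g a \<in> W" if "a \<in> filling_columns f u \<inter> V" for a
    using ex[OF row, of a] that by (auto simp: g_def)
  have "inj_on g (filling_columns f u \<inter> V)"
  proof (rule inj_onI)
    fix a a' assume a: "a \<in> filling_columns f u \<inter> V" "a' \<in> filling_columns f u \<inter> V" "g a = g a'"
    then have "row a = row a'"
      using g ordered_filling_column_inj[OF f] by metis
    then show "a = a'" using row a by (metis IntD1 option.inject)
  qed
  moreover have "g ` (filling_columns f u \<inter> V) \<subseteq> filling_columns f v \<inter> W"
    using g by (auto simp: filling_columns_def)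
  ultimately show ?thesis using \<open>finite W\<close> by (intro card_inj_on_le) auto
qed

lemma filling_columns_insert:
  assumes "f (i, j) = None"
  shows "filling_columns (f((i, j) := Some y)) = (filling_columns f)(i := insert y (filling_columns f i))"
proof (intro ext set_eqI)
  fix m x
  show "x \<in> filling_columns (f((i, j) := Some y)) m
      \<longleftrightarrow> x \<in> ((filling_columns f)(i := insert y (filling_columns f i))) m"
  proof (cases "m = i")
    case True
    have "(\<exists>j'. (if j' = j then Some y else f (i, j')) = Some x) \<longleftrightarrow> x = y \<or> (\<exists>j'. f (i, j') = Some x)"
      using assms by (metis option.distinct(1) option.inject)
    then show ?thesis by (simp add: filling_columns_def True)
  qed (simp add: filling_columns_def)
qed

lemma filling_columns_delete:
  assumes "f (i, j) = Some y" "\<And>j'. f (i, j') = Some y \<Longrightarrow> j' = j"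
  shows "filling_columns (f((i, j) := None)) = (filling_columns f)(i := filling_columns f i - {y})"
proof (intro ext set_eqI)
  fix m x
  show "x \<in> filling_columns (f((i, j) := None)) m
      \<longleftrightarrow> x \<in> ((filling_columns f)(i := filling_columns f i - {y})) m"
  proof (cases "m = i")
    case True
    have "(\<exists>j'. (if j' = j then None else f (i, j')) = Some x) \<longleftrightarrow> x \<noteq> y \<and> (\<exists>j'. f (i, j') = Some x)"
      using assms by (metis option.distinct(1) option.inject)
    then show ?thesis by (auto simp: filling_columns_def True)
  qed (simp add: filling_columns_def)
qed

section \<open>The sliding hole\<close>

definition order_ideal :: "box set \<Rightarrow> bool" where
  "order_ideal L \<longleftrightarrow> (\<forall>i j i' j'. (i, j) \<in> L \<longrightarrow> i' \<le> i \<longrightarrow> j' \<le> j \<longrightarrow> (i', j') \<in> L)"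

lemma order_idealD: "order_ideal L \<Longrightarrow> (i, j) \<in> L \<Longrightarrow> i' \<le> i \<Longrightarrow> j' \<le> j \<Longrightarrow> (i', j') \<in> L"
  unfolding order_ideal_def by blast

text \<open>\<open>L\<close> is the outer diagram and \<open>I\<close> the inner one without the
  corner where the slide starts. Both stay fixed during the slide; only the hole wanders.\<close>

definition punctured :: "box set \<Rightarrow> box set \<Rightarrow> (box \<Rightarrow> nat option) \<Rightarrow> box \<Rightarrow> bool" where
  "punctured L I f h \<longleftrightarrow> order_ideal L \<and> order_ideal I \<and> h \<in> L - I \<and>
     dom f = L - I - {h} \<and> ordered_filling f"

lemma puncturedD:
  assumes "punctured L I f h"
  shows "order_ideal L" "order_ideal I" "h \<in> L" "h \<notin> I" "ordered_filling f"
    "f b = Some x \<Longrightarrow> b \<in> L \<and> b \<notin> I \<and> b \<noteq> h"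
    "b \<in> L \<Longrightarrow> b \<notin> I \<Longrightarrow> b \<noteq> h \<Longrightarrow> \<exists>x. f b = Some x"
proof -
  have dom: "dom f = L - I - {h}" using assms by (simp add: punctured_def)
  show "order_ideal L" "order_ideal I" "h \<in> L" "h \<notin> I" "ordered_filling f"
    using assms by (auto simp: punctured_def)
  show "f b = Some x \<Longrightarrow> b \<in> L \<and> b \<notin> I \<and> b \<noteq> h"
    using domI[of f b x] dom by simp
  show "b \<in> L \<Longrightarrow> b \<notin> I \<Longrightarrow> b \<noteq> h \<Longrightarrow> \<exists>x. f b = Some x"
    using domD[of b f] dom by simp
qed

lemma punctured_from_below:
  assumes p: "punctured L I f (i, j)" and x: "f (i, Suc j) = Some x"
    and le: "\<And>y. f (Suc i, j) = Some y \<Longrightarrow> x \<le> y"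
  shows "punctured L I (f((i, j) := Some x, (i, Suc j) := None)) (i, Suc j)"
    (is "punctured L I ?g _")
proof -
  note pD = puncturedD[OF p]
  note fD = ordered_fillingD[OF pD(5)]
  \<comment> \<open>The comparison takes a detour through box \<open>(i', Suc j)\<close>, which is
    filled because \<open>L\<close> and \<open>I\<close> are order ideals.\<close>
  have left: "u \<le> x" if "f (i', j) = Some u" "i' < i" for i' u
  proof -
    have "(i', Suc j) \<in> L" "(i', Suc j) \<notin> I"
      using pD(6)[OF x] pD(6)[OF that(1)] that(2)
        order_idealD[OF pD(1), of i "Suc j" i' "Suc j"] order_idealD[OF pD(2), of i' "Suc j" i' j]
      by auto
    then obtain v where v: "f (i', Suc j) = Some v" using pD(7)[of "(i', Suc j)"] \<open>i' < i\<close> by auto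
    then show ?thesis
      using fD(2)[OF that(1) v] fD(3)[OF v x that(2)] by simp
  qed
  have right: "x \<le> u" if "f (i', j) = Some u" "i < i'" for i' u
  proof -
    have "(Suc i, j) \<in> L" "(Suc i, j) \<notin> I"
      using pD(6)[OF that(1)] pD(4) that(2)
        order_idealD[OF pD(1), of i' j "Suc i" j] order_idealD[OF pD(2), of "Suc i" j i j]
      by auto
    then obtain v where v: "f (Suc i, j) = Some v" using pD(7)[of "(Suc i, j)"] by auto
    then show ?thesis
      using le[OF v] fD(3)[OF v that(1)] that v by (cases "i' = Suc i") auto
  qed
  have above: "u < x" if "f (i, j') = Some u" "j' < j" for j' u
    using fD(2)[OF that(1) x] that(2) by simp
  have below: "x < u" if "f (i, j') = Some u" "Suc j < j'" for j' u
    using fD(2)[OF x that(1)] that(2) by simp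
  have "ordered_filling ?g"
    unfolding ordered_filling_def
  proof (intro conjI allI impI ballI)
    fix u assume "u \<in> ran ?g"
    then show "0 < u" using fD(1) x by (auto simp: ran_def split: if_splits)
  next
    fix i' j1 j2 u v
    assume "j1 < j2 \<and> ?g (i', j1) = Some u \<and> ?g (i', j2) = Some v"
    then show "u < v"
      using fD(2)[of i' j1 u j2 v] above[of j1 u] below[of j2 v] by (auto split: if_splits)
  next
    fix i1 i2 j' u v
    assume "i1 < i2 \<and> ?g (i1, j') = Some u \<and> ?g (i2, j') = Some v"
    then show "u \<le> v"
      using fD(3)[of i1 j' u i2 v] left[of i1 u] right[of i2 v] by (auto split: if_splits)
  qed
  moreover have "dom ?g = L - I - {(i, Suc j)}"
    using p x pD(3,4) by (auto simp: punctured_def)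
  ultimately show ?thesis
    using pD pD(6)[OF x] by (simp add: punctured_def)
qed

text \<open>Entries of column \<open>i\<close> up to \<open>y\<close> lie above the hole and their
  right neighbours are smaller than \<open>y\<close>; with \<open>y\<close> itself, column
  \<open>i + 1\<close> has more entries in any interval ending at \<open>y\<close>. Entries of
  column \<open>i + 1\<close> larger than \<open>y\<close> lie in rows under the hole, and their
  left neighbours are larger than \<open>y\<close> as well. So the height has its first maximum at
  \<open>y\<close>.\<close>

lemma punctured_from_right:
  assumes p: "punctured L I f (i, j)" and y: "f (Suc i, j) = Some y"
    and less: "\<And>x. f (i, Suc j) = Some x \<Longrightarrow> y < x"
  shows "punctured L I (f((i, j) := Some y, (Suc i, j) := None)) (Suc i, j)"
    (is "punctured L I ?g _")
    and "step (filling_columns f)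
      (filling_columns (f((i, j) := Some y, (Suc i, j) := None)))"
proof -
  note pD = puncturedD[OF p]
  note fD = ordered_fillingD[OF pD(5)]
  have above_dom: "\<exists>v. f (Suc i, j') = Some v \<and> u \<le> v \<and> v < y"
    if "f (i, j') = Some u" "j' < j" for j' u
  proof -
    have "(Suc i, j') \<in> L" "(Suc i, j') \<notin> I"
      using pD(6)[OF y] pD(6)[OF that(1)] that(2)
        order_idealD[OF pD(1), of "Suc i" j "Suc i" j'] order_idealD[OF pD(2), of "Suc i" j' i j']
      by auto
    then obtain v where v: "f (Suc i, j') = Some v" using pD(7)[of "(Suc i, j')"] by auto
    then show ?thesis
      using fD(3)[OF that(1) v] fD(2)[OF v y that(2)] by simp
  qed
  have above: "u < y" if "f (i, j') = Some u" "j' < j" for j' u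
    using above_dom[OF that] by auto
  \<comment> \<open>Strictness is due to the tie rule of the slide: \<open>y\<close> moves only if
    it is smaller than the entry under the hole.\<close>
  have below: "y < u" if "f (i, j') = Some u" "j < j'" for j' u
  proof -
    have "(i, Suc j) \<in> L" "(i, Suc j) \<notin> I"
      using pD(6)[OF that(1)] pD(4) that(2)
        order_idealD[OF pD(1), of i j' i "Suc j"] order_idealD[OF pD(2), of i "Suc j" i j]
      by auto
    then obtain v where v: "f (i, Suc j) = Some v" using pD(7)[of "(i, Suc j)"] by auto
    then show ?thesis
      using less[OF v] fD(2)[OF v that(1)] that v by (cases "j' = Suc j") auto
  qed
  have left: "u \<le> y" if "f (i', j) = Some u" "i' < i" for i' u
    using fD(3)[OF that(1) y] that(2) by simp
  have right: "y \<le> u" if "f (i', j) = Some u" "Suc i < i'" for i' u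
    using fD(3)[OF y that(1)] that(2) by simp
  have "ordered_filling ?g"
    unfolding ordered_filling_def
  proof (intro conjI allI impI ballI)
    fix u assume "u \<in> ran ?g"
    then show "0 < u" using fD(1) y by (auto simp: ran_def split: if_splits)
  next
    fix i' j1 j2 u v
    assume "j1 < j2 \<and> ?g (i', j1) = Some u \<and> ?g (i', j2) = Some v"
    then show "u < v"
      using fD(2)[of i' j1 u j2 v] above[of j1 u] below[of j2 v] by (auto split: if_splits)
  next
    fix i1 i2 j' u v
    assume "i1 < i2 \<and> ?g (i1, j') = Some u \<and> ?g (i2, j') = Some v"
    then show "u \<le> v"
      using fD(3)[of i1 j' u i2 v] left[of i1 u] right[of i2 v] by (auto split: if_splits)
  qed
  moreover have "dom ?g = L - I - {(Suc i, j)}"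
    using p y pD(3,4) by (auto simp: punctured_def)
  ultimately show "punctured L I ?g (Suc i, j)"
    using pD pD(6)[OF y] by (simp add: punctured_def)

  let ?c = "filling_columns f"
  have split: "int (card (C \<inter> {..v})) = int (card (C \<inter> {..u})) + int (card (C \<inter> {u<..v}))"
    if "u \<le> v" for C :: "nat set" and u v
  proof -
    have "C \<inter> {..v} = C \<inter> {..u} \<union> C \<inter> {u<..v}"
      using that by auto
    moreover have "C \<inter> {..u} \<inter> (C \<inter> {u<..v}) = {}" by auto
    ultimately have "card (C \<inter> {..v}) = card (C \<inter> {..u}) + card (C \<inter> {u<..v})"
      by (simp add: card_Un_disjoint)
    then show ?thesis by simp
  qed
  have "movable ?c i y"
  proof (rule movableI)
    show "0 < y" using fD(1)[OF y] .
    show "height ?c i x < height ?c i y" if "x < y" for x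
    proof -
      have "card (?c i \<inter> {x<..y}) \<le> card (?c (Suc i) \<inter> {x<..<y})"
      proof (rule card_filling_columns_le[OF pD(5)])
        show "\<exists>b. f (Suc i, j') = Some b \<and> b \<in> {x<..<y}"
          if "f (i, j') = Some a" "a \<in> {x<..y}" for j' a
        proof -
          have "j' \<noteq> j" using pD(6)[OF that(1)] by auto
          moreover have "\<not> j < j'" using below[OF that(1)] that(2) by fastforce
          ultimately have "j' < j" by simp
          then show ?thesis using above_dom[OF that(1)] that(2) by fastforce
        qed
      qed simp
      moreover have "?c (Suc i) \<inter> {x<..y} = insert y (?c (Suc i) \<inter> {x<..<y})"
        using y \<open>x < y\<close> by (auto simp: filling_columns_def)
      ultimately have "card (?c i \<inter> {x<..y}) < card (?c (Suc i) \<inter> {x<..y})"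
        by simp
      then show ?thesis
        using split[of x y "?c i"] split[of x y "?c (Suc i)"] that by (simp add: height_def)
    qed
    show "height ?c i x \<le> height ?c i y" if "y \<le> x" for x
    proof -
      have "card (?c (Suc i) \<inter> {y<..x}) \<le> card (?c i \<inter> {y<..x})"
      proof (rule card_filling_columns_le[OF pD(5)])
        show "\<exists>b. f (i, j') = Some b \<and> b \<in> {y<..x}"
          if a: "f (Suc i, j') = Some a" "a \<in> {y<..x}" for j' a
        proof -
          have "j < j'"
            using fD(2)[OF a(1) y] a y by (cases j' j rule: linorder_cases) auto
          then have "(i, j') \<in> L" "(i, j') \<notin> I"
            using pD(6)[OF a(1)] pD(4) order_idealD[OF pD(1), of "Suc i" j' i j']
              order_idealD[OF pD(2), of i j' i j] by auto
          then obtain b where b: "f (i, j') = Some b" using pD(7)[of "(i, j')"] \<open>j < j'\<close> by auto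
          then show ?thesis
            using below[OF b \<open>j < j'\<close>] fD(3)[OF b a(1)] a(2) by auto
        qed
      qed simp
      then show ?thesis
        using split[OF that, of "?c i"] split[OF that, of "?c (Suc i)"] by (simp add: height_def)
    qed
  qed
  moreover have "filling_columns ?g = move ?c i y"
  proof -
    have "f (i, j) = None" using pD(6)[of "(i, j)"] by (cases "f (i, j)") auto
    then have c1: "filling_columns (f((i, j) := Some y)) = ?c(i := insert y (?c i))"
      by (rule filling_columns_insert)
    define f1 where "f1 = f((i, j) := Some y)"
    have f1: "f1 (Suc i, j') = f (Suc i, j')" for j'
      by (simp add: f1_def)
    have "filling_columns (f1((Suc i, j) := None))
        = (filling_columns f1)(Suc i := filling_columns f1 (Suc i) - {y})"
    proof (rule filling_columns_delete)
      show "f1 (Suc i, j) = Some y" using y by (simp only: f1)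
      show "j' = j" if "f1 (Suc i, j') = Some y" for j'
        using that y unfolding f1 by (rule ordered_filling_column_inj[OF pD(5)])
    qed
    then show ?thesis
      unfolding f1_def c1 move_def by simp
  qed
  ultimately show "step ?c (filling_columns ?g)"
    using stepI[of ?c i y] by simp
qed

text \<open>The last two conjuncts make the final hole an outside corner, so that a shape remains
  when it is removed from \<open>L\<close>.\<close>

lemma slide_hole_invariant:
  assumes "slide_hole f h g d" "punctured L I f h"
  shows "punctured L I g d \<and> step\<^sup>*\<^sup>* (filling_columns f) (filling_columns g) \<and>
    (fst d, Suc (snd d)) \<notin> L \<and> (Suc (fst d), snd d) \<notin> L"
  using assms
proof (induction rule: slide_hole.induct)
  case (finished f i j)
  note pD = puncturedD[OF finished.prems]
  have "(i, Suc j) \<notin> I" "(Suc i, j) \<notin> I"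
    using pD(4) order_idealD[OF pD(2), of i "Suc j" i j]
      order_idealD[OF pD(2), of "Suc i" j i j] by auto
  then have "(i, Suc j) \<notin> L" "(Suc i, j) \<notin> L"
    using pD(7)[of "(i, Suc j)"] pD(7)[of "(Suc i, j)"] finished.hyps by auto
  then show ?case using finished.prems by simp
next
  case (from_below f i j x g d)
  note pD = puncturedD[OF from_below.prems]
  have "f (i, j) = None" using pD(6)[of "(i, j)"] by (cases "f (i, j)") auto
  \<comment> \<open>Deleting before inserting keeps \<open>x\<close> from occurring twice in the
    column, which \<open>filling_columns_delete\<close> does not allow.\<close>
  define f1 where "f1 = f((i, Suc j) := None)"
  have "filling_columns f1 = (filling_columns f)(i := filling_columns f i - {x})"
    unfolding f1_def
  proof (rule filling_columns_delete)
    show "f (i, Suc j) = Some x" by (fact from_below.hyps(1))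
    show "j' = Suc j" if "f (i, j') = Some x" for j'
      using that from_below.hyps(1) by (rule ordered_filling_column_inj[OF pD(5)])
  qed
  moreover have "filling_columns (f1((i, j) := Some x))
      = (filling_columns f1)(i := insert x (filling_columns f1 i))"
    by (rule filling_columns_insert) (simp add: f1_def \<open>f (i, j) = None\<close>)
  moreover have "x \<in> filling_columns f i"
    using from_below.hyps(1) by (auto simp: filling_columns_def)
  moreover have "f((i, j) := Some x, (i, Suc j) := None) = f1((i, j) := Some x)"
    unfolding f1_def by (rule fun_upd_twist) simp
  ultimately have eq: "filling_columns (f((i, j) := Some x, (i, Suc j) := None)) = filling_columns f"
    by (simp only: fun_upd_same fun_upd_upd insert_Diff fun_upd_triv)
  have "punctured L I (f((i, j) := Some x, (i, Suc j) := None)) (i, Suc j)"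
    using from_below.prems from_below.hyps(1) by (rule punctured_from_below) (rule from_below.hyps(2))
  from from_below.IH[OF this] show ?case
    unfolding eq .
next
  case (from_right f i j y g d)
  have "punctured L I (f((i, j) := Some y, (Suc i, j) := None)) (Suc i, j)"
    using from_right.prems from_right.hyps(1) by (rule punctured_from_right) (rule from_right.hyps(2))
  note IH = from_right.IH[OF this]
  have "step (filling_columns f) (filling_columns (f((i, j) := Some y, (Suc i, j) := None)))"
    using from_right.prems from_right.hyps(1) by (rule punctured_from_right) (rule from_right.hyps(2))
  then have "step\<^sup>*\<^sup>* (filling_columns f) (filling_columns g)"
    using conjunct1[OF conjunct2[OF IH]] by (rule converse_rtranclp_into_rtranclp)
  then show ?case using IH by (elim conjE) (intro conjI)
qed

text \<open>Every step takes the hole to the next antidiagonal, so fewer boxes of \<open>L\<close>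
  lie on later ones.\<close>

lemma slide_hole_exists:
  assumes "finite L" "punctured L I f h"
  shows "\<exists>g d. slide_hole f h g d"
  using assms(2)
proof (induction "card {b \<in> L. fst h + snd h < fst b + snd b}" arbitrary: f h rule: less_induct)
  case less
  obtain i j where h: "h = (i, j)" by (cases h)
  note p = less.prems[unfolded h]
  have dec: "card {b \<in> L. fst h' + snd h' < fst b + snd b} < card {b \<in> L. fst h + snd h < fst b + snd b}"
    if "h' \<in> L" "fst h' + snd h' = Suc (i + j)" for h'
  proof (rule psubset_card_mono)
    show "finite {b \<in> L. fst h + snd h < fst b + snd b}" using assms(1) by simp
    show "{b \<in> L. fst h' + snd h' < fst b + snd b} \<subset> {b \<in> L. fst h + snd h < fst b + snd b}"
    proof (unfold subset_not_subset_eq, intro conjI)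
      show "{b \<in> L. fst h' + snd h' < fst b + snd b} \<subseteq> {b \<in> L. fst h + snd h < fst b + snd b}"
        using that h by auto
      show "\<not> {b \<in> L. fst h + snd h < fst b + snd b} \<subseteq> {b \<in> L. fst h' + snd h' < fst b + snd b}"
        using that h by (intro notI) (drule subsetD[of _ _ h'], simp_all)
    qed
  qed
  consider "f (i, Suc j) = None" "f (Suc i, j) = None"
    | x where "f (i, Suc j) = Some x" "\<And>y. f (Suc i, j) = Some y \<Longrightarrow> x \<le> y"
    | y where "f (Suc i, j) = Some y" "\<And>x. f (i, Suc j) = Some x \<Longrightarrow> y < x"
  proof (cases "\<exists>x. f (i, Suc j) = Some x \<and> (\<forall>y. f (Suc i, j) = Some y \<longrightarrow> x \<le> y)")
    case True
    then show thesis using that(2) by blast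
  next
    case False
    show thesis
    proof (cases "f (Suc i, j)")
      case None
      then show thesis using False that(1) by (cases "f (i, Suc j)") auto
    next
      case (Some y)
      then show thesis using False that(3)[of y] by (auto simp: not_le)
    qed
  qed
  then show ?case
  proof cases
    case 1
    then show ?thesis unfolding h using slide_hole.finished by blast
  next
    case 2
    have "(i, Suc j) \<in> L" using puncturedD(6)[OF p 2(1)] by simp
    then have "card {b \<in> L. fst (i, Suc j) + snd (i, Suc j) < fst b + snd b}
        < card {b \<in> L. fst h + snd h < fst b + snd b}"
      by (rule dec) simp
    moreover have "punctured L I (f((i, j) := Some x, (i, Suc j) := None)) (i, Suc j)"
      using p 2(1) by (rule punctured_from_below) (rule 2(2))
    ultimately have "\<exists>g d. slide_hole (f((i, j) := Some x, (i, Suc j) := None)) (i, Suc j) g d"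
      by (rule less.hyps)
    then obtain g d where "slide_hole (f((i, j) := Some x, (i, Suc j) := None)) (i, Suc j) g d"
      by (elim exE)
    with 2(1) 2(2) have "slide_hole f (i, j) g d"
      by (rule slide_hole.from_below)
    then show ?thesis unfolding h by blast
  next
    case 3
    have "(Suc i, j) \<in> L" using puncturedD(6)[OF p 3(1)] by simp
    then have "card {b \<in> L. fst (Suc i, j) + snd (Suc i, j) < fst b + snd b}
        < card {b \<in> L. fst h + snd h < fst b + snd b}"
      by (rule dec) simp
    moreover have "punctured L I (f((i, j) := Some y, (Suc i, j) := None)) (Suc i, j)"
      using p 3(1) by (rule punctured_from_right) (rule 3(2))
    ultimately have "\<exists>g d. slide_hole (f((i, j) := Some y, (Suc i, j) := None)) (Suc i, j) g d"
      by (rule less.hyps)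
    then obtain g d where "slide_hole (f((i, j) := Some y, (Suc i, j) := None)) (Suc i, j) g d"
      by (elim exE)
    with 3(1) 3(2) have "slide_hole f (i, j) g d"
      by (rule slide_hole.from_right)
    then show ?thesis unfolding h by blast
  qed
qed

section \<open>Shapes, corners and whole slides\<close>

lemma in_diagram [simp]: "(i, j) \<in> diagram z \<longleftrightarrow> i < length z \<and> j < z ! i"
  by (simp add: diagram_def)

lemma finite_diagram: "finite (diagram z)"
proof -
  have "diagram z = (SIGMA i:{..<length z}. {..<z ! i})"
    by (auto simp: diagram_def)
  then show ?thesis by simp
qed

lemma shape_nth_mono: "shape z \<Longrightarrow> i \<le> j \<Longrightarrow> j < length z \<Longrightarrow> z ! j \<le> z ! i"
  by (cases "i = j") (auto simp: shape_def sorted_wrt_iff_nth_less)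

lemma shapeI:
  assumes "\<And>i. i < length z \<Longrightarrow> 0 < z ! i" "\<And>i. Suc i < length z \<Longrightarrow> z ! Suc i \<le> z ! i"
  shows "shape z"
proof -
  have "z ! j \<le> z ! i" if "i \<le> j" "j < length z" for i j
    using that
  proof (induction rule: dec_induct)
    case (step m)
    then show ?case using assms(2)[of m] by simp
  qed simp
  then show ?thesis
    using assms(1) by (auto simp: shape_def sorted_wrt_iff_nth_less in_set_conv_nth)
qed

lemma shape_nth_pos: "shape z \<Longrightarrow> i < length z \<Longrightarrow> 0 < z ! i"
  by (simp add: shape_def)

lemma order_ideal_diagram: "shape z \<Longrightarrow> order_ideal (diagram z)"
  unfolding order_ideal_def using shape_nth_mono by (fastforce dest: le_less_trans)

lemma shape_remove_corner:
  assumes z: "shape z" and c: "(i, j) \<in> diagram z" "(i, Suc j) \<notin> diagram z" "(Suc i, j) \<notin> diagram z"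
  obtains z' where "shape z'" "diagram z' = diagram z - {(i, j)}"
proof (cases j)
  case 0
  \<comment> \<open>A corner in the top row is the only box of the last column, as a further column
    would have positive length. The whole column is dropped.\<close>
  have i: "length z = Suc i" "z ! i = 1"
    using c shape_nth_pos[OF z, of "Suc i"] 0 by (cases "Suc i < length z"; auto)+
  show thesis
  proof (rule that[of "butlast z"])
    show "shape (butlast z)"
      using shape_nth_pos[OF z] shape_nth_mono[OF z]
      by (intro shapeI) (auto simp: nth_butlast)
    show "diagram (butlast z) = diagram z - {(i, j)}"
      using i 0 by (auto simp: diagram_def nth_butlast less_Suc_eq)
  qed
next
  case (Suc j')
  have i: "i < length z" "z ! i = Suc j" "Suc i < length z \<Longrightarrow> z ! Suc i \<le> j"
    using c by auto
  show thesis
  proof (rule that[of "z[i := j]"])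
    show "shape (z[i := j])"
    proof (rule shapeI)
      fix m assume "Suc m < length (z[i := j])"
      then show "z[i := j] ! Suc m \<le> z[i := j] ! m"
        using i shape_nth_mono[OF z, of m "Suc m"] by (auto simp: nth_list_update)
    qed (use shape_nth_pos[OF z] Suc i(1) in \<open>auto simp: nth_list_update\<close>)
    show "diagram (z[i := j]) = diagram z - {(i, j)}"
      using i by (auto simp: diagram_def nth_list_update split: if_splits)
  qed
qed

text \<open>Inclusion of diagrams captures the conditions on the lengths since the inner lengths are
  positive; a length 0 would be invisible in the diagram.\<close>

lemma is_skew_tableau_iff:
  "is_skew_tableau X \<longleftrightarrow> shape (outer X) \<and> shape (inner X) \<and>
     diagram (inner X) \<subseteq> diagram (outer X) \<and>
     dom (entry X) = diagram (outer X) - diagram (inner X) \<and> ordered_filling (entry X)"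
proof -
  have eq: "diagram (inner X) \<subseteq> diagram (outer X) \<longleftrightarrow>
      length (inner X) \<le> length (outer X) \<and> (\<forall>i<length (inner X). inner X ! i \<le> outer X ! i)"
    if "shape (inner X)"
  proof
    assume sub: "diagram (inner X) \<subseteq> diagram (outer X)"
    have "i < length (outer X) \<and> inner X ! i \<le> outer X ! i" if i: "i < length (inner X)" for i
    proof -
      have "(i, inner X ! i - 1) \<in> diagram (outer X)"
        using shape_nth_pos[OF \<open>shape (inner X)\<close> i] i by (intro subsetD[OF sub]) simp
      then show ?thesis by auto
    qed
    then show "length (inner X) \<le> length (outer X) \<and>
        (\<forall>i<length (inner X). inner X ! i \<le> outer X ! i)"
      by (meson less_irrefl not_le)
  next
    assume le: "length (inner X) \<le> length (outer X) \<and>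
        (\<forall>i<length (inner X). inner X ! i \<le> outer X ! i)"
    show "diagram (inner X) \<subseteq> diagram (outer X)"
    proof
      fix b assume "b \<in> diagram (inner X)"
      then show "b \<in> diagram (outer X)"
        using le by (cases b) (auto dest: less_le_trans)
    qed
  qed
  show ?thesis
  proof (cases "shape (inner X)")
    case True
    show ?thesis
      by (simp only: is_skew_tableau_def ordered_filling_def eq[OF True] conj_assoc)
  qed (simp add: is_skew_tableau_def)
qed

lemma punctured_inside_corner:
  assumes X: "is_skew_tableau X" and c: "inside_corner (inner X) c"
  shows "punctured (diagram (outer X)) (diagram (inner X) - {c}) (entry X) c"
proof -
  obtain i j where ij: "c = (i, j)" by (cases c)
  have in_c: "(i, j) \<in> diagram (inner X)" "(i, Suc j) \<notin> diagram (inner X)"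
    "(Suc i, j) \<notin> diagram (inner X)"
    using c by (simp_all add: inside_corner_def ij)
  have X': "shape (outer X)" "shape (inner X)" "diagram (inner X) \<subseteq> diagram (outer X)"
    "dom (entry X) = diagram (outer X) - diagram (inner X)" "ordered_filling (entry X)"
    using X unfolding is_skew_tableau_iff by auto
  have I: "order_ideal (diagram (inner X))" using order_ideal_diagram X'(2) .
  have "order_ideal (diagram (inner X) - {c})"
    unfolding order_ideal_def
  proof (intro allI impI)
    fix a b a' b' assume ab: "(a, b) \<in> diagram (inner X) - {c}" "a' \<le> a" "b' \<le> b"
    then have "(a', b') \<in> diagram (inner X)"
      using order_idealD[OF I] by blast
    moreover have "(a', b') \<noteq> c"
    proof
      assume "(a', b') = c"
      then have "i \<le> a" "j \<le> b" "\<not> (a = i \<and> b = j)"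
        using ab ij by auto
      then have "Suc i \<le> a \<or> Suc j \<le> b" by linarith
      then show False
        using order_idealD[OF I, of a b "Suc i" j] order_idealD[OF I, of a b i "Suc j"]
          ab(1) in_c \<open>i \<le> a\<close> \<open>j \<le> b\<close> by blast
    qed
    ultimately show "(a', b') \<in> diagram (inner X) - {c}" by simp
  qed
  then show ?thesis
    using X' in_c order_ideal_diagram[OF X'(1)] unfolding punctured_def ij by blast
qed

lemma jdt_slide_step:
  assumes X: "is_skew_tableau X" and "jdt_slide X Y"
  shows "is_skew_tableau Y" "step\<^sup>*\<^sup>* (filling_columns (entry X)) (filling_columns (entry Y))"
proof -
  obtain c d where cd: "inside_corner (inner X) c" "slide_hole (entry X) c (entry Y) d"
    "shape (inner Y)" "diagram (inner Y) = diagram (inner X) - {c}"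
    "shape (outer Y)" "diagram (outer Y) = diagram (outer X) - {d}"
    using assms(2) by (auto simp: jdt_slide_def)
  note inv = slide_hole_invariant[OF cd(2) punctured_inside_corner[OF X cd(1)]]
  show "step\<^sup>*\<^sup>* (filling_columns (entry X)) (filling_columns (entry Y))"
    using inv by blast
  have p: "punctured (diagram (outer X)) (diagram (inner X) - {c}) (entry Y) d"
    using inv by blast
  have "diagram (inner X) \<subseteq> diagram (outer X)"
    using X unfolding is_skew_tableau_iff by blast
  then show "is_skew_tableau Y"
    using p cd unfolding is_skew_tableau_iff punctured_def by auto
qed

lemma jdt_slides_step:
  assumes "jdt_slide\<^sup>*\<^sup>* X Y" "is_skew_tableau X"
  shows "is_skew_tableau Y \<and> step\<^sup>*\<^sup>* (filling_columns (entry X)) (filling_columns (entry Y))"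
  using assms
proof (induction rule: rtranclp_induct)
  case (step Y Z)
  then show ?case using jdt_slide_step[of Y Z] by (meson rtranclp_trans)
qed simp

lemma jdt_slide_exists:
  assumes X: "is_skew_tableau X" and ne: "inner X \<noteq> []"
  obtains Y where "jdt_slide X Y" "card (diagram (inner Y)) < card (diagram (inner X))"
proof -
  \<comment> \<open>The lowest box of the last inner column is always an inside corner.\<close>
  define i where "i = length (inner X) - 1"
  define j where "j = inner X ! i - 1"
  have shapes: "shape (inner X)" "shape (outer X)"
    using X by (auto simp: is_skew_tableau_iff)
  have "i < length (inner X)" using ne by (simp add: i_def)
  then have c: "inside_corner (inner X) (i, j)"
    using shape_nth_pos[OF shapes(1), of i] by (auto simp: inside_corner_def j_def i_def)
  then have in_c: "(i, j) \<in> diagram (inner X)" "(i, Suc j) \<notin> diagram (inner X)"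
    "(Suc i, j) \<notin> diagram (inner X)"
    by (simp_all add: inside_corner_def)
  note p = punctured_inside_corner[OF X c]
  obtain g d where g: "slide_hole (entry X) (i, j) g d"
    using slide_hole_exists[OF finite_diagram p] by blast
  note inv = slide_hole_invariant[OF g p]
  have "d \<in> diagram (outer X)" using inv puncturedD(3) by blast
  then obtain z where z: "shape z" "diagram z = diagram (outer X) - {d}"
    using inv shape_remove_corner[OF shapes(2), of "fst d" "snd d"] by auto
  obtain y where y: "shape y" "diagram y = diagram (inner X) - {(i, j)}"
    using shape_remove_corner[OF shapes(1) in_c] .
  show thesis
  proof (rule that[of "Skew z y g"])
    show "jdt_slide X (Skew z y g)"
      unfolding jdt_slide_def using c g z y by (intro exI[of _ "(i, j)"] exI[of _ d]) simp
    show "card (diagram (inner (Skew z y g))) < card (diagram (inner X))"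
      using card_Diff1_less[OF finite_diagram in_c(1)] by (simp add: y(2))
  qed
qed

section \<open>Rectification as normal form\<close>

lemma inner_length_conv:
  assumes "is_skew_tableau X"
  shows "entry X (i, j) \<noteq> None \<longleftrightarrow> i < length (outer X) \<and> inner_length X i \<le> j \<and> j < outer X ! i"
proof -
  have "(i, j) \<in> dom (entry X) \<longleftrightarrow> (i, j) \<in> diagram (outer X) - diagram (inner X)"
    using assms by (simp add: is_skew_tableau_iff)
  then show ?thesis by (auto simp: inner_length_def domIff)
qed

lemma length_skew_columns [simp]: "length (skew_columns X) = length (outer X)"
  by (simp add: skew_columns_def)

lemma skew_column:
  assumes X: "is_skew_tableau X" and i: "i < length (outer X)"
  shows "set (skew_columns X ! i) = filling_columns (entry X) i"
    "sorted_wrt (<) (skew_columns X ! i)"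
proof -
  have col: "skew_columns X ! i
      = map (\<lambda>j. the (entry X (i, j))) [inner_length X i..<outer X ! i]"
    using i by (simp add: skew_columns_def)
  have dom: "entry X (i, j) \<noteq> None \<longleftrightarrow> inner_length X i \<le> j \<and> j < outer X ! i" for j
    using inner_length_conv[OF X] i by simp
  have ord: "ordered_filling (entry X)" using X by (simp add: is_skew_tableau_iff)
  show "set (skew_columns X ! i) = filling_columns (entry X) i"
  proof (intro set_eqI iffI)
    fix x assume "x \<in> set (skew_columns X ! i)"
    then obtain j where "inner_length X i \<le> j" "j < outer X ! i" "x = the (entry X (i, j))"
      by (auto simp: col)
    then have "entry X (i, j) = Some x" using dom[of j] by simp
    then show "x \<in> filling_columns (entry X) i" by (auto simp: filling_columns_def)
  next
    fix x assume "x \<in> filling_columns (entry X) i"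
    then obtain j where j: "entry X (i, j) = Some x" by (auto simp: filling_columns_def)
    then have "j \<in> set [inner_length X i..<outer X ! i]" using dom[of j] by simp
    then have "the (entry X (i, j)) \<in> set (skew_columns X ! i)" unfolding col by simp
    then show "x \<in> set (skew_columns X ! i)" using j by simp
  qed
  show "sorted_wrt (<) (skew_columns X ! i)"
    unfolding col sorted_wrt_iff_nth_less
  proof (intro allI impI)
    fix m n assume mn: "m < n"
      "n < length (map (\<lambda>j. the (entry X (i, j))) [inner_length X i..<outer X ! i])"
    then have "entry X (i, inner_length X i + m) \<noteq> None" "entry X (i, inner_length X i + n) \<noteq> None"
      using dom[of "inner_length X i + m"] dom[of "inner_length X i + n"] by simp_all
    then obtain x y where "entry X (i, inner_length X i + m) = Some x"
        "entry X (i, inner_length X i + n) = Some y"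
      by blast
    then show "map (\<lambda>j. the (entry X (i, j))) [inner_length X i..<outer X ! i] ! m
        < map (\<lambda>j. the (entry X (i, j))) [inner_length X i..<outer X ! i] ! n"
      using ordered_fillingD(2)[OF ord, of i _ x _ y] mn by simp
  qed
qed

lemma skew_column_eq:
  assumes "is_skew_tableau X" "i < length (outer X)"
  shows "skew_columns X ! i = sorted_list_of_set (filling_columns (entry X) i)"
  using skew_column[OF assms] by (metis sorted_list_of_set.idem_if_sorted_distinct strict_sorted_iff)

lemma length_skew_column:
  assumes "is_skew_tableau X" "i < length (outer X)"
  shows "length (skew_columns X ! i) = card (filling_columns (entry X) i)"
  using skew_column[OF assms] by (metis distinct_card strict_sorted_iff)

lemma columns_within_filling:
  assumes X: "is_skew_tableau X"
  shows "columns_within (length (outer X)) (filling_columns (entry X))"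
proof -
  have "filling_columns (entry X) i = {}" if "length (outer X) \<le> i" for i
    using inner_length_conv[OF X, of i] that by (auto simp: filling_columns_def)
  moreover have "finite (filling_columns (entry X) i)" if "i < length (outer X)" for i
    using skew_column(1)[OF X that] by (metis List.finite_set)
  moreover have "0 \<notin> filling_columns (entry X) i" for i
    using ordered_fillingD(1) X unfolding is_skew_tableau_iff filling_columns_def by blast
  ultimately show ?thesis
    unfolding columns_within_def by (metis finite.emptyI not_le)
qed

lemma normal_filling:
  assumes X: "is_skew_tableau X" and inner: "inner X = []"
  shows "normal (filling_columns (entry X))"
  unfolding normal_def
proof (intro allI)
  fix i x
  have ord: "ordered_filling (entry X)" using X by (simp add: is_skew_tableau_iff)
  have outer: "shape (outer X)" using X by (simp add: is_skew_tableau_iff)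
  have "card (filling_columns (entry X) (Suc i) \<inter> {..x})
      \<le> card (filling_columns (entry X) i \<inter> {..x})"
  proof (rule card_filling_columns_le[OF ord])
    fix j a assume a: "entry X (Suc i, j) = Some a" "a \<in> {..x}"
    then have "entry X (i, j) \<noteq> None"
      using inner_length_conv[OF X, of "Suc i" j] inner_length_conv[OF X, of i j]
        shape_nth_mono[OF outer, of i "Suc i"] inner by (simp add: inner_length_def)
    then obtain b where b: "entry X (i, j) = Some b" by blast
    then show "\<exists>b. entry X (i, j) = Some b \<and> b \<in> {..x}"
      using ordered_fillingD(3)[OF ord b a(1)] a(2) by simp
  qed simp
  then show "height (filling_columns (entry X)) i x \<le> 0"
    by (simp add: height_def)
qed

lemma skew_columns_straight: "skew_columns (straight T) = T"
proof (rule nth_equalityI)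
  fix i assume "i < length (skew_columns (straight T))"
  then have i: "i < length T" by (simp add: straight_def)
  then show "skew_columns (straight T) ! i = T ! i"
    by (intro nth_equalityI) (auto simp: skew_columns_def straight_def inner_length_def)
qed (simp add: straight_def)

lemma straight_skew_columns:
  assumes X: "is_skew_tableau X" and inner: "inner X = []"
  shows "straight (skew_columns X) = X"
proof -
  have len: "map length (skew_columns X) = outer X"
    using inner by (intro nth_equalityI) (auto simp: skew_columns_def inner_length_def)
  have "(if (i, j) \<in> diagram (outer X) then Some (skew_columns X ! i ! j) else None) = entry X (i, j)"
    for i j
    using inner_length_conv[OF X, of i j] inner
    by (auto simp: skew_columns_def inner_length_def)
  then have "(\<lambda>(i, j). if (i, j) \<in> diagram (outer X) then Some (skew_columns X ! i ! j) else None)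
      = entry X"
    by (intro ext) auto
  then show ?thesis
    unfolding straight_def len using inner by (cases X) simp
qed

text \<open>Columns of a straight tableau are nonempty, so the nonempty sets count the columns, and
  sorting each set recovers the lists.\<close>

lemma straight_eqI:
  assumes S: "is_skew_tableau (straight S)" and T: "is_skew_tableau (straight T)"
    and eq: "filling_columns (entry (straight S)) = filling_columns (entry (straight T))"
  shows "S = T"
proof -
  have count: "length U = card {i. filling_columns (entry (straight U)) i \<noteq> {}}"
    if U: "is_skew_tableau (straight U)" for U
  proof -
    have "filling_columns (entry (straight U)) i \<noteq> {} \<longleftrightarrow> i < length U" for i
    proof
      show "filling_columns (entry (straight U)) i \<noteq> {} \<Longrightarrow> i < length U"
        by (auto simp: filling_columns_def straight_def split: if_splits)
      assume i: "i < length U"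
      then have "entry (straight U) (i, 0) = Some (U ! i ! 0)"
        using U by (auto simp: straight_def is_skew_tableau_iff shape_def)
      then show "filling_columns (entry (straight U)) i \<noteq> {}"
        by (auto simp: filling_columns_def)
    qed
    then show ?thesis by simp
  qed
  have outer: "length (outer (straight U)) = length U" for U
    by (simp add: straight_def)
  have "skew_columns (straight S) = skew_columns (straight T)"
    using count[OF S] count[OF T] skew_column_eq[OF S] skew_column_eq[OF T]
    by (intro nth_equalityI) (simp_all add: eq outer)
  then show ?thesis by (simp add: skew_columns_straight)
qed

lemma is_skew_tableau_straight:
  assumes T: "is_tableau T"
  shows "is_skew_tableau (straight T)"
proof -
  have row: "T ! i ! j \<le> T ! i' ! j" if "i < i'" "i' < length T" "j < length (T ! i')" for i i' j
    using T that by (auto simp: is_tableau_def)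
  have col: "T ! i ! j < T ! i ! j'" if "i < length T" "j < j'" "j' < length (T ! i)" for i j j'
  proof -
    have "sorted_wrt (<) (T ! i)" using T that(1) by (simp add: is_tableau_def)
    then show ?thesis using that by (simp add: sorted_wrt_iff_nth_less)
  qed
  have pos: "0 < T ! i ! j" if "i < length T" "j < length (T ! i)" for i j
  proof -
    have "T ! i \<in> set T" using that(1) by simp
    then have "\<forall>x\<in>set (T ! i). 0 < x" using T unfolding is_tableau_def by blast
    then show ?thesis using that(2) by simp
  qed
  have entry: "entry (straight T) (i, j) = Some x \<longleftrightarrow>
      i < length T \<and> j < length (T ! i) \<and> x = T ! i ! j" for i j x
    by (auto simp: straight_def)
  have "ordered_filling (entry (straight T))"
    unfolding ordered_filling_def ran_def using row col pos by (auto simp: entry)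
  moreover have "dom (entry (straight T)) = diagram (outer (straight T)) - diagram (inner (straight T))"
    by (auto simp: straight_def diagram_def split: if_splits)
  ultimately show ?thesis
    using T by (auto simp: is_skew_tableau_iff is_tableau_def straight_def shape_def diagram_def)
qed

lemma rectification_exists:
  assumes "is_skew_tableau X"
  shows "\<exists>T. rectifies_to X T"
  using assms
proof (induction "card (diagram (inner X))" arbitrary: X rule: less_induct)
  case less
  show ?case
  proof (cases "inner X = []")
    case True
    then show ?thesis
      using straight_skew_columns[OF less.prems] unfolding rectifies_to_def
      by (metis rtranclp.rtrancl_refl)
  next
    case False
    then obtain Y where Y: "jdt_slide X Y" "card (diagram (inner Y)) < card (diagram (inner X))"
      using jdt_slide_exists[OF less.prems] by blast
    then show ?thesis
      using less.hyps[OF Y(2) jdt_slide_step(1)[OF less.prems Y(1)]] unfolding rectifies_to_def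
      by (meson converse_rtranclp_into_rtranclp)
  qed
qed

text \<open>Slides are sequences of moves and straight fillings are normal. Uniqueness of the
  rectification is thus inherited from the confluence of the moves.\<close>

lemma rectifies_to_normal_form:
  assumes X: "is_skew_tableau X" and T: "rectifies_to X T"
  shows "is_skew_tableau (straight T)"
    "normal_form (filling_columns (entry X)) = filling_columns (entry (straight T))"
proof -
  note steps = jdt_slides_step[OF T[unfolded rectifies_to_def] X]
  then show "is_skew_tableau (straight T)" by blast
  moreover have "inner (straight T) = []" by (simp add: straight_def)
  ultimately show "normal_form (filling_columns (entry X)) = filling_columns (entry (straight T))"
    using normal_form_eqI[OF columns_within_filling[OF X]] steps normal_filling by blast
qed

text \<open>
  Columns that meet only in corners, each entirely below the next one, form a skew tableau
  whatever their entries are.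
\<close>

lemma skew_tableau_with_columns:
  assumes d: "columns_within k d" and ne: "\<And>i. i < k \<Longrightarrow> d i \<noteq> {}"
  obtains X where "is_skew_tableau X" "length (outer X) = k" "filling_columns (entry X) = d"
proof -
  \<comment> \<open>Column \<open>i\<close> takes the rows from \<open>s (Suc i)\<close> up to, but
    excluding, \<open>s i\<close>. No two columns share a row, so the row condition is
    vacuous.\<close>
  define s where "s i = (\<Sum>l\<in>{i..<k}. card (d l))" for i
  have s: "s i = card (d i) + s (Suc i)" "0 < card (d i)" if "i < k" for i
    using that d ne[OF that] by (auto simp: s_def sum.atLeast_Suc_lessThan columns_within_def card_gt_0_iff)
  have s_pos: "0 < s i" if "i < k" for i
    using s[OF that] by simp
  have s_k: "s k = 0" by (simp add: s_def)
  have s_mono: "s i' \<le> s i" if "i \<le> i'" for i i'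
    unfolding s_def using that by (intro sum_mono2) auto
  define f where "f = (\<lambda>(i, j). if i < k \<and> s (Suc i) \<le> j \<and> j < s i
      then Some (sorted_list_of_set (d i) ! (j - s (Suc i))) else None)"
  \<comment> \<open>The inner shape has \<open>k - 1\<close> columns only, since
    \<open>s k = 0\<close> is not a positive length.\<close>
  define X where "X = Skew (map s [0..<k]) (map (\<lambda>i. s (Suc i)) [0..<k - 1]) f"
  have f: "f (i, j) = Some x \<longleftrightarrow> i < k \<and> s (Suc i) \<le> j \<and> j < s i \<and>
      x = sorted_list_of_set (d i) ! (j - s (Suc i))" for i j x
    by (auto simp: f_def)
  have fin: "finite (d i)" for i using d by (simp add: columns_within_def)
  have cols: "filling_columns f = d"
  proof
    fix i
    show "filling_columns f i = d i"
    proof (cases "i < k")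
      case True
      have "x \<in> set (sorted_list_of_set (d i)) \<longleftrightarrow> (\<exists>n<card (d i). x = sorted_list_of_set (d i) ! n)"
        for x
        unfolding in_set_conv_nth by (simp add: eq_commute)
      then have "x \<in> d i \<longleftrightarrow> (\<exists>n<card (d i). x = sorted_list_of_set (d i) ! n)" for x
        using fin[of i] by simp
      moreover have "(\<exists>n<card (d i). x = sorted_list_of_set (d i) ! n) \<longleftrightarrow>
          (\<exists>j. s (Suc i) \<le> j \<and> j < s i \<and> x = sorted_list_of_set (d i) ! (j - s (Suc i)))" for x
      proof
        assume "\<exists>n<card (d i). x = sorted_list_of_set (d i) ! n"
        then obtain n where "n < card (d i)" "x = sorted_list_of_set (d i) ! n" by blast
        then show "\<exists>j. s (Suc i) \<le> j \<and> j < s i \<and> x = sorted_list_of_set (d i) ! (j - s (Suc i))"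
          using s(1)[OF True] by (intro exI[of _ "n + s (Suc i)"]) simp
      next
        assume "\<exists>j. s (Suc i) \<le> j \<and> j < s i \<and> x = sorted_list_of_set (d i) ! (j - s (Suc i))"
        then obtain j where "s (Suc i) \<le> j" "j < s i"
          "x = sorted_list_of_set (d i) ! (j - s (Suc i))" by blast
        then show "\<exists>n<card (d i). x = sorted_list_of_set (d i) ! n"
          using s(1)[OF True] by (intro exI[of _ "j - s (Suc i)"]) simp
      qed
      moreover have "x \<in> filling_columns f i \<longleftrightarrow>
          (\<exists>j. s (Suc i) \<le> j \<and> j < s i \<and> x = sorted_list_of_set (d i) ! (j - s (Suc i)))" for x
        using True by (simp add: filling_columns_def f)
      ultimately show ?thesis by (intro set_eqI) (simp only:)
    next
      case False
      then show ?thesis using d by (simp add: filling_columns_def f columns_within_def)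
    qed
  qed
  have "shape (outer X)"
    unfolding X_def by (rule shapeI) (simp_all add: s_pos s_mono)
  moreover have "shape (inner X)"
    unfolding X_def by (rule shapeI) (simp_all add: s_pos s_mono)
  moreover have "diagram (inner X) \<subseteq> diagram (outer X)"
  proof
    fix b assume "b \<in> diagram (inner X)"
    then obtain i j where "b = (i, j)" "i < k - 1" "j < s (Suc i)"
      by (cases b) (auto simp: X_def)
    then show "b \<in> diagram (outer X)"
      using s_mono[of i "Suc i"] by (simp add: X_def)
  qed
  moreover have "dom (entry X) = diagram (outer X) - diagram (inner X)"
  proof -
    have dom_f: "(i, j) \<in> dom f \<longleftrightarrow> i < k \<and> j < s i \<and> \<not> (i < k - 1 \<and> j < s (Suc i))" for i j
    proof (cases "Suc i = k")
      case True
      then show ?thesis using s_k by (auto simp: domIff f_def)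
    next
      case False
      then have "i < k - 1 \<longleftrightarrow> i < k" by linarith
      then show ?thesis by (auto simp: domIff f_def not_less)
    qed
    show ?thesis
    proof (rule set_eqI)
      fix b show "b \<in> dom (entry X) \<longleftrightarrow> b \<in> diagram (outer X) - diagram (inner X)"
        by (cases b) (simp add: X_def dom_f cong: conj_cong)
    qed
  qed
  moreover have "ordered_filling (entry X)"
    unfolding ordered_filling_def
  proof (intro conjI allI impI ballI)
    fix x assume "x \<in> ran (entry X)"
    then obtain i j where "f (i, j) = Some x" by (auto simp: ran_def X_def)
    then have "x \<in> d i" using cols by (auto simp: filling_columns_def)
    then show "0 < x" using d by (auto simp: columns_within_def intro: gr0I)
  next
    fix i j j' x y
    assume "j < j' \<and> entry X (i, j) = Some x \<and> entry X (i, j') = Some y"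
    then have "i < k" "s (Suc i) \<le> j" "j < j'" "j' < s i"
      "x = sorted_list_of_set (d i) ! (j - s (Suc i))"
      "y = sorted_list_of_set (d i) ! (j' - s (Suc i))"
      by (auto simp: X_def f)
    then show "x < y"
      using strict_sorted_list_of_set[of "d i"] s(1)[of i]
      by (simp add: sorted_wrt_iff_nth_less)
  next
    fix i i' j x y
    assume "i < i' \<and> entry X (i, j) = Some x \<and> entry X (i', j) = Some y"
    then have "s (Suc i) \<le> j" "j < s i'" "i < i'" by (auto simp: X_def f)
    then show "x \<le> y" using s_mono[of "Suc i" i'] by simp
  qed
  ultimately have "is_skew_tableau X" unfolding is_skew_tableau_iff by blast
  then show thesis using that cols by (simp add: X_def)
qed

section \<open>Scanning and the right key\<close>

text \<open>\<open>v\<close> is the member of the subsequence chosen last. Emptied columns stay in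
  the list for now, so that positions are preserved.\<close>

fun strip :: "nat \<Rightarrow> tableau \<Rightarrow> tableau" where
  "strip v [] = []"
| "strip v (U # Us) =
     (if v \<le> last U then butlast U # strip (last U) Us else U # strip v Us)"

fun scan_end :: "nat \<Rightarrow> nat list \<Rightarrow> nat" where
  "scan_end v [] = v"
| "scan_end v (x # xs) = scan_end (if v \<le> x then x else v) xs"

lemma ewis_next_ge: "j \<in> set (ewis_next v i xs) \<Longrightarrow> i \<le> j"
  by (induction v i xs rule: ewis_next.induct) (auto split: if_splits)

lemma map_upt_Suc_shift: "map f [0..<Suc n] = f 0 # map (\<lambda>j. f (Suc j)) [0..<n]"
  by (simp add: upt_conv_Cons map_Suc_upt[symmetric] o_def del: upt_Suc)

text \<open>The offset \<open>i\<close> is general because \<open>ewis_next\<close> keeps counting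
  while the remaining columns are numbered from 0 again.\<close>

lemma strip_eq_map:
  "map (\<lambda>j. if i + j \<in> set (ewis_next v i (map last Us)) then butlast (Us ! j) else Us ! j)
     [0..<length Us] = strip v Us"
proof (induction Us arbitrary: v i)
  case (Cons U Us)
  have "i \<notin> set (ewis_next w (Suc i) xs)" for w xs
    using ewis_next_ge[of i w "Suc i" xs] by auto
  then show ?case
    using Cons.IH[of "Suc i" "last U"] Cons.IH[of "Suc i" v]
    by (simp add: map_upt_Suc_shift del: upt_Suc cong: if_cong)
qed simp

lemma last_ewis_next:
  "last (v # map (\<lambda>j. xs ! (j - i)) (ewis_next v i xs)) = scan_end v xs"
proof (induction xs arbitrary: v i)
  case (Cons x xs)
  have eq: "map (\<lambda>j. (x # xs) ! (j - i)) (ewis_next w (Suc i) xs)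
      = map (\<lambda>j. xs ! (j - Suc i)) (ewis_next w (Suc i) xs)" for w
    by (intro map_cong refl) (auto dest!: ewis_next_ge simp: nth_Cons' )
  let ?w = "if v \<le> x then x else v"
  have "last (v # map (\<lambda>j. (x # xs) ! (j - i)) (ewis_next v i (x # xs)))
      = last (?w # map (\<lambda>j. (x # xs) ! (j - i)) (ewis_next ?w (Suc i) xs))"
    by simp
  also have "\<dots> = scan_end ?w xs"
    unfolding eq by (rule Cons.IH)
  finally show ?case by simp
qed simp

lemma remove_scanned_eq:
  "remove_scanned (C # U) = filter (\<lambda>C. C \<noteq> []) (butlast C # strip (last C) U)"
proof -
  have "map (\<lambda>i. if i \<in> set (ewis_indices (bottoms (C # U))) then butlast ((C # U) ! i) else (C # U) ! i)
      [0..<length (C # U)] = butlast C # strip (last C) U"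
    using strip_eq_map[of 1 "last C" U]
    by (simp add: map_upt_Suc_shift bottoms_def del: upt_Suc cong: if_cong)
  then show ?thesis by (simp only: remove_scanned_def)
qed

lemma S1B_eq: "S1B (C # U) = scan_end (last C) (map last U)"
proof -
  have eq: "map (\<lambda>j. (last C # map last U) ! j) (ewis_next (last C) 1 (map last U))
      = map (\<lambda>j. map last U ! (j - 1)) (ewis_next (last C) 1 (map last U))"
    by (intro map_cong refl) (auto dest!: ewis_next_ge simp: nth_Cons')
  show ?thesis
    unfolding S1B_def ewis_def bottoms_def list.map ewis_indices.simps nth_Cons_0 eq
    by (rule last_ewis_next)
qed

text \<open>\<open>absorb\<close> first compares the two heads only: either the bottom entry of the
  column replaces \<open>a\<close> and leaves the column, or \<open>a\<close> stays. This is one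
  step of a scan, so the first entry can run through all columns before the others start, and these
  meet the stripped columns.\<close>

lemma foldl_absorb_Cons:
  assumes "\<And>U. U \<in> set Us \<Longrightarrow> U \<noteq> []"
  shows "foldl absorb (a # as) (map rev Us)
    = scan_end a (map last Us) # foldl absorb as (map rev (strip a Us))"
  using assms
proof (induction Us arbitrary: a as)
  case (Cons U Us)
  obtain B x where "U = B @ [x]"
    using Cons.prems[of U] by (cases U rule: rev_cases) auto
  then show ?case using Cons by simp
qed simp

text \<open>Absorption into an empty column has no effect, so the columns that
  \<open>remove_scanned\<close> drops do not matter.\<close>

lemma foldl_absorb_filter:
  "foldl absorb as (map rev (filter (\<lambda>C. C \<noteq> []) Us)) = foldl absorb as (map rev Us)"
  by (induction Us arbitrary: as) auto

lemma absorb_eq_Nil: "absorb as bs = [] \<longleftrightarrow> as = [] \<and> bs = []"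
  by (induction as bs rule: absorb.induct) auto

lemma foldl_absorb_eq_Nil: "foldl absorb as Bs = [] \<longleftrightarrow> as = [] \<and> (\<forall>B\<in>set Bs. B = [])"
  by (induction Bs arbitrary: as) (auto simp: absorb_eq_Nil)

text \<open>
  The assumption on the length ensures that no boxes are left over when the first column has
  been used up, since \<open>S1\<close> would then go on with the next column.
\<close>

lemma S1_eq_foldl_absorb:
  assumes "\<And>D. D \<in> set (C # U) \<Longrightarrow> D \<noteq> []"
    and "length (foldl absorb (rev C) (map rev U)) = length C"
  shows "S1 (C # U) = rev (foldl absorb (rev C) (map rev U))"
  using assms
proof (induction "length C" arbitrary: C U)
  case 0
  then show ?case by simp
next
  case (Suc n)
  let ?B = "butlast C" and ?V = "strip (last C) U"
  have "C = ?B @ [last C]" using Suc.prems(1)[of C] by simp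
  then have rev_C: "rev C = last C # rev ?B" by (metis rev_eq_Cons_iff rev_rev_ident)
  have fold: "foldl absorb (rev C) (map rev U)
      = scan_end (last C) (map last U) # foldl absorb (rev ?B) (map rev ?V)"
    unfolding rev_C
    by (rule foldl_absorb_Cons) (use Suc.prems(1) in simp)
  then have len: "length (foldl absorb (rev ?B) (map rev ?V)) = length ?B"
    using Suc.prems(2) by simp
  have "S1 (remove_scanned (C # U)) = rev (foldl absorb (rev ?B) (map rev ?V))"
  proof (cases "?B = []")
    case True
    then have nil: "foldl absorb (rev ?B) (map rev ?V) = []" using len by simp
    then have "\<forall>B\<in>set ?V. B = []" by (simp add: foldl_absorb_eq_Nil)
    then have "filter (\<lambda>C. C \<noteq> []) (?B # ?V) = []" using True by simp
    then have "remove_scanned (C # U) = []" by (simp only: remove_scanned_eq)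
    then show ?thesis using nil by (simp add: S1.simps)
  next
    case False
    have "S1 (?B # filter (\<lambda>C. C \<noteq> []) ?V)
        = rev (foldl absorb (rev ?B) (map rev (filter (\<lambda>C. C \<noteq> []) ?V)))"
    proof (rule Suc.hyps(1))
      show "n = length ?B" using Suc.hyps(2) by simp
      show "length (foldl absorb (rev ?B) (map rev (filter (\<lambda>C. C \<noteq> []) ?V))) = length ?B"
        using len by (simp only: foldl_absorb_filter)
    qed (use False in auto)
    then show ?thesis using False by (simp add: remove_scanned_eq foldl_absorb_filter)
  qed
  then show ?case
    by (subst S1.simps) (simp add: S1B_eq fold)
qed

lemma scanning_tableau_eq: "scanning_tableau T = map (\<lambda>i. S1 (drop i T)) [0..<length T]"
  by (induction T) (simp_all add: map_upt_Suc_shift del: upt_Suc)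

lemma rev_sorted_list_of_absorb_set:
  "rev (sorted_list_of_set (absorb_set A B))
     = absorb (rev (sorted_list_of_set A)) (rev (sorted_list_of_set B))"
proof -
  let ?l = "absorb (rev (sorted_list_of_set A)) (rev (sorted_list_of_set B))"
  have "sorted_wrt (<) (rev ?l)"
    using sorted_absorb[OF sorted_rev_list_of_set sorted_rev_list_of_set, of A B]
    by (simp add: sorted_wrt_rev)
  then have "sorted_list_of_set (set (rev ?l)) = rev ?l"
    by (metis sorted_list_of_set.idem_if_sorted_distinct strict_sorted_iff)
  then show ?thesis by (simp add: absorb_set_def)
qed

lemma rev_sorted_list_of_foldl_absorb_set:
  "rev (sorted_list_of_set (foldl absorb_set A Bs))
     = foldl absorb (rev (sorted_list_of_set A)) (map (\<lambda>B. rev (sorted_list_of_set B)) Bs)"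
  by (induction Bs arbitrary: A) (simp_all add: rev_sorted_list_of_absorb_set)

section \<open>Frank skew tableaux and their last columns\<close>

lemma square_sum_filling:
  assumes "is_skew_tableau X"
  shows "square_sum (length (outer X)) (filling_columns (entry X))
    = (\<Sum>l\<in>#mset (map length (skew_columns X)). l\<^sup>2)"
proof -
  let ?c = "filling_columns (entry X)"
  have "map length (skew_columns X) = map (\<lambda>i. card (?c i)) [0..<length (outer X)]"
    using length_skew_column[OF assms] by (intro nth_equalityI) auto
  then have "(\<Sum>l\<in>#mset (map length (skew_columns X)). l\<^sup>2)
      = sum_list (map (\<lambda>i. (card (?c i))\<^sup>2) [0..<length (outer X)])"
    by (simp add: sum_mset_sum_list o_def flip: mset_map)
  also have "\<dots> = square_sum (length (outer X)) ?c"
    by (simp add: interv_sum_list_conv_sum_set_nat square_sum_def atLeast0LessThan)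
  finally show ?thesis by simp
qed

lemma rectifies_to_unique:
  assumes X: "is_skew_tableau X" and S: "rectifies_to X S" and T: "rectifies_to X T"
  shows "S = T"
  using rectifies_to_normal_form[OF X S] rectifies_to_normal_form[OF X T]
  by (intro straight_eqI) auto

lemma tableau_columns:
  assumes "is_tableau T"
  shows "columns_within (length T) (filling_columns (entry (straight T)))"
    "normal (filling_columns (entry (straight T)))"
    "i < length T \<Longrightarrow> T ! i = sorted_list_of_set (filling_columns (entry (straight T)) i)"
    "i < length T \<Longrightarrow> card (filling_columns (entry (straight T)) i) = length (T ! i)"
    "i < length T \<Longrightarrow> T ! i \<noteq> []"
proof -
  note skew = is_skew_tableau_straight[OF assms]
  have outer: "length (outer (straight T)) = length T" by (simp add: straight_def)
  show "columns_within (length T) (filling_columns (entry (straight T)))"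
    using columns_within_filling[OF skew] by (simp add: outer)
  show "normal (filling_columns (entry (straight T)))"
    using normal_filling[OF skew] by (simp add: straight_def)
  show "T ! i = sorted_list_of_set (filling_columns (entry (straight T)) i)"
      "card (filling_columns (entry (straight T)) i) = length (T ! i)" if "i < length T"
    using skew_column_eq[OF skew, of i] length_skew_column[OF skew, of i] that
    by (simp_all add: skew_columns_straight outer)
  show "T ! i \<noteq> []" if "i < length T"
    using assms that shape_nth_pos[of "map length T" i] by (simp add: is_tableau_def)
qed

lemma frank_last_column:
  assumes T: "is_tableau T" and i: "i < length T" and X: "frank X" "rectifies_to X T"
    and len: "length (last (skew_columns X)) = length (T ! i)"
  shows "last (skew_columns X)
    = sorted_list_of_set (absorb_from (length T) (filling_columns (entry (straight T))) i)"
proof -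
  let ?c = "filling_columns (entry X)" and ?k = "length T"
  have skew: "is_skew_tableau X" using X(1) by (simp add: frank_def)
  \<comment> \<open>\<open>frank\<close> speaks of some rectification; uniqueness identifies it with
    \<open>T\<close>.\<close>
  have mset: "mset (map length (skew_columns X)) = mset (map length T)"
    using X rectifies_to_unique[OF skew] by (auto simp: frank_def)
  from arg_cong[OF this, of size] have outer: "length (outer X) = ?k" by simp
  have nf: "normal_form ?c = filling_columns (entry (straight T))"
    using rectifies_to_normal_form(2)[OF skew X(2)] .
  \<comment> \<open>The normal form consists of the columns of \<open>T\<close>, whose lengths are
    those of \<open>X\<close> in another order, so the square sums agree.\<close>
  have "extremal ?k ?c"
    unfolding extremal_def nf
    using columns_within_filling[OF skew] square_sum_filling[OF skew]
      square_sum_filling[OF is_skew_tableau_straight[OF T]] mset outer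
    by (simp add: skew_columns_straight) (simp add: straight_def)
  moreover have ne: "skew_columns X \<noteq> []" using outer i by (metis length_skew_columns length_0_conv not_less_zero)
  then have last: "last (skew_columns X) = skew_columns X ! (?k - 1)"
    by (simp add: last_conv_nth outer)
  moreover have "?k - 1 < length (outer X)" using i outer by simp
  ultimately have "?c (?k - 1) = absorb_from ?k (filling_columns (entry (straight T))) i"
    using extremal_last_column[of ?k ?c i] i len length_skew_column[OF skew, of "?k - 1"]
      tableau_columns(4)[OF T i] nf by simp
  then show ?thesis
    using skew_column_eq[OF skew, of "?k - 1"] last i outer by simp
qed

text \<open>Inverse moves give columns with the \<open>i\<close>-th length at the end and the same
  normal form as \<open>T\<close>. Any skew tableau with these columns therefore rectifies to
  \<open>T\<close>.\<close>

lemma frank_exists: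
  assumes T: "is_tableau T" and i: "i < length T"
  obtains X where "frank X" "rectifies_to X T" "length (last (skew_columns X)) = length (T ! i)"
proof -
  let ?k = "length T" and ?c = "filling_columns (entry (straight T))"
  note c = tableau_columns[OF T]
  obtain d where d: "columns_within ?k d" "normal_form d = ?c"
    "\<forall>j<i. card (d j) = card (?c j)"
    "\<forall>j. i \<le> j \<longrightarrow> j < ?k - 1 \<longrightarrow> card (d j) = card (?c (Suc j))"
    "card (d (?k - 1)) = card (?c i)"
  proof -
    have "i \<le> ?k - 1" "?k - 1 < ?k" using i by auto
    then show thesis using push_right[OF c(1,2)] that by blast
  qed
  let ?L = "map length T"
  have mset: "mset (take i ?L @ drop (Suc i) ?L @ [?L ! i]) = mset ?L"
  proof -
    have "?L = take i ?L @ ?L ! i # drop (Suc i) ?L"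
      using i by (intro id_take_nth_drop) simp
    from arg_cong[OF this, of mset] show ?thesis by simp
  qed
  have card_d: "card (d j) = (take i ?L @ drop (Suc i) ?L @ [?L ! i]) ! j" if "j < ?k" for j
    using that i d(3-5) c(4) by (cases "j = ?k - 1") (auto simp: nth_append min_def)
  have "d j \<noteq> {}" if "j < ?k" for j
  proof
    assume "d j = {}"
    then have "(take i ?L @ drop (Suc i) ?L @ [?L ! i]) ! j = 0"
      using card_d[OF that] by simp
    moreover have "(take i ?L @ drop (Suc i) ?L @ [?L ! i]) ! j
        \<in> set (take i ?L @ drop (Suc i) ?L @ [?L ! i])"
      using that i by (intro nth_mem) (simp add: min_def)
    ultimately have "0 \<in> set ?L"
      by (metis mset mset_eq_setD)
    then show False using T by (auto simp: is_tableau_def shape_def)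
  qed
  then obtain X where X: "is_skew_tableau X" "length (outer X) = ?k" "filling_columns (entry X) = d"
    using skew_tableau_with_columns[OF d(1)] by blast
  have lens: "map length (skew_columns X) = take i ?L @ drop (Suc i) ?L @ [?L ! i]"
    using card_d length_skew_column[OF X(1)] X(2,3) i
    by (intro nth_equalityI) (simp_all add: min_def)
  obtain S where S: "rectifies_to X S" using rectification_exists[OF X(1)] by blast
  have "S = T"
    using rectifies_to_normal_form[OF X(1) S] X(3) d(2) is_skew_tableau_straight[OF T]
    by (intro straight_eqI) simp_all
  then have "frank X"
    using X(1) S lens mset unfolding frank_def by metis
  moreover have "length (last (skew_columns X)) = last (map length (skew_columns X))"
    using X(2) i by (intro last_map[symmetric]) (metis length_skew_columns length_0_conv not_less_zero)
  then have "length (last (skew_columns X)) = length (T ! i)"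
    using i by (simp add: lens)
  ultimately show thesis using that S \<open>S = T\<close> by blast
qed

lemma S1_eq_absorb_from:
  assumes T: "is_tableau T" and i: "i < length T"
  shows "S1 (drop i T)
    = sorted_list_of_set (absorb_from (length T) (filling_columns (entry (straight T))) i)"
proof -
  let ?c = "filling_columns (entry (straight T))" and ?k = "length T"
  note c = tableau_columns[OF T]
  have "map rev (drop (Suc i) T) = map (\<lambda>B. rev (sorted_list_of_set B)) (map ?c [Suc i..<?k])"
    using c(3) by (intro nth_equalityI) simp_all
  then have fold: "foldl absorb (rev (T ! i)) (map rev (drop (Suc i) T))
      = rev (sorted_list_of_set (absorb_from ?k ?c i))"
    using c(3)[OF i] by (simp add: absorb_from_def rev_sorted_list_of_foldl_absorb_set)
  obtain X where X: "frank X" "rectifies_to X T" "length (last (skew_columns X)) = length (T ! i)"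
    using frank_exists[OF T i] .
  \<comment> \<open>The length of the absorbed column is read off a frank skew tableau that ends
    with it.\<close>
  have "length (sorted_list_of_set (absorb_from ?k ?c i)) = length (T ! i)"
    using frank_last_column[OF T i X] X(3) by simp
  then have "S1 (T ! i # drop (Suc i) T) = rev (foldl absorb (rev (T ! i)) (map rev (drop (Suc i) T)))"
  proof (intro S1_eq_foldl_absorb)
    fix D assume "D \<in> set (T ! i # drop (Suc i) T)"
    then have "D \<in> set T" using i by (auto dest: in_set_dropD)
    then show "D \<noteq> []" using c(5) by (metis in_set_conv_nth)
  qed (simp add: fold)
  then show ?thesis
    using i by (simp add: fold Cons_nth_drop_Suc)
qed

lemma right_key_column_eq:
  assumes T: "is_tableau T" and i: "i < length T"
  shows "right_key_column T i = S1 (drop i T)"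
proof -
  obtain X where X: "frank X" "rectifies_to X T" "length (last (skew_columns X)) = length (T ! i)"
    using frank_exists[OF T i] .
  have eq: "last (skew_columns Y) = S1 (drop i T)"
    if "frank Y" "rectifies_to Y T" "length (last (skew_columns Y)) = length (T ! i)" for Y
    using frank_last_column[OF T i that] S1_eq_absorb_from[OF T i] by simp
  show ?thesis
    unfolding right_key_column_def
  proof (rule the_equality)
    show "\<exists>Y. frank Y \<and> rectifies_to Y T \<and> S1 (drop i T) = last (skew_columns Y) \<and>
        length (S1 (drop i T)) = length (T ! i)"
      using X eq[OF X] by metis
  qed (use eq in auto)
qed

theorem theorem4p5:
  fixes T :: tableau
  assumes "is_tableau T"
  shows "right_key T = scanning_tableau T"
  using right_key_column_eq[OF assms] by (simp add: right_key_def scanning_tableau_eq)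

end
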